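(* Let $\mathcal{U}\subset\mathbb{C}^2$ be an open neighborhood of the origin and let $F:\mathcal{U}\to\mathbb{C}^2$ be an analytic map such that $F(0,0)=(0,0)$ and $DF(0,0)$ is diagonalizable with eigenvalues $\lambda$ and $\mu$. Assume that $F$ has a meromorphic first integral $H$ in $\mathcal{U}$. (i) If $\lambda\mu\neq 0$, then there exists $(p,q)\in\mathbb{Z}^2$, $(p,q)\neq(0,0)$, such that $\lambda^p\mu^q=1$. (ii) If $\lambda\neq 0$ and $\mu=0$, then there exists $n\in\mathbb{N}^+$ such that $\lambda^n=1$.
   Context: Two analytic functions $P,Q:\mathcal{U}\subset\mathbb{C}^2\to\mathbb{C}$ are coprime if the points of the set $\{(x,y)\in\mathcal{U}: P(x,y)=Q(x,y)=0\}$ are isolated. A function $H=P/Q$ with $P,Q$ coprime (and $Q\not\equiv 0$) is called a meromorphic function. A meromorphic first integral of an analytic map $F:\mathcal{U}\to\mathbb{C}^2$ is a meromorphic function $H=P/Q$, not constant on any neighborhood of the origin, such that $P(F(x,y))\,Q(x,y)=P(x,y)\,Q(F(x,y))$ for all $(x,y)\in\mathcal{U}$ (for which both sides are defined, i.e. $F(x,y)\in\mathcal{U}$). $\mathbb{N}^+$ denotes the positive integers. *)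

theory Defs
  imports "HOL-Analysis.Analysis"
begin

text \<open>
  Points of \<open>\<complex>\<^sup>2\<close> are pairs. Analyticity in two complex variables means local expansion
  in a convergent double power series on a polydisc.
\<close>

definition analytic2_on :: "(complex \<times> complex \<Rightarrow> complex) \<Rightarrow> (complex \<times> complex) set \<Rightarrow> bool"
    (infixl \<open>analytic2'_on\<close> 50)
  where "f analytic2_on U \<longleftrightarrow>
    (\<forall>(a, b)\<in>U. \<exists>r>0. \<exists>c :: nat \<Rightarrow> nat \<Rightarrow> complex.
       \<forall>x\<in>ball a r. \<forall>y\<in>ball b r.
         ((\<lambda>(i, j). c i j * (x - a) ^ i * (y - b) ^ j) has_sum f (x, y)) UNIV)"

definition analytic2_map_on ::
    "(complex \<times> complex \<Rightarrow> complex \<times> complex) \<Rightarrow> (complex \<times> complex) set \<Rightarrow> bool"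
  where "analytic2_map_on F U \<longleftrightarrow>
    (\<lambda>z. fst (F z)) analytic2_on U \<and> (\<lambda>z. snd (F z)) analytic2_on U"

definition jacobian_matrix2 ::
    "(complex \<times> complex \<Rightarrow> complex \<times> complex) \<Rightarrow> complex \<times> complex \<Rightarrow> complex ^ 2 ^ 2"
  where "jacobian_matrix2 F z = vector
    [vector [deriv (\<lambda>x. fst (F (x, snd z))) (fst z), deriv (\<lambda>y. fst (F (fst z, y))) (snd z)],
     vector [deriv (\<lambda>x. snd (F (x, snd z))) (fst z), deriv (\<lambda>y. snd (F (fst z, y))) (snd z)]]"

definition diagonalizable_with_eigenvalues ::
    "complex ^ 2 ^ 2 \<Rightarrow> complex \<Rightarrow> complex \<Rightarrow> bool"
  where "diagonalizable_with_eigenvalues A l m \<longleftrightarrow>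
    (\<exists>S :: complex ^ 2 ^ 2. invertible S \<and> A = S ** vector [vector [l, 0], vector [0, m]] ** matrix_inv S)"

definition coprime2_on ::
    "(complex \<times> complex) set \<Rightarrow> (complex \<times> complex \<Rightarrow> complex) \<Rightarrow> (complex \<times> complex \<Rightarrow> complex) \<Rightarrow> bool"
  where "coprime2_on U P Q \<longleftrightarrow> discrete {z \<in> U. P z = 0 \<and> Q z = 0}"

text \<open>A meromorphic function \<open>P / Q\<close> is represented by its numerator and denominator.\<close>

definition meromorphic2_on ::
    "(complex \<times> complex) set \<Rightarrow> (complex \<times> complex \<Rightarrow> complex) \<Rightarrow> (complex \<times> complex \<Rightarrow> complex) \<Rightarrow> bool"
  where "meromorphic2_on U P Q \<longleftrightarrow>
    P analytic2_on U \<and> Q analytic2_on U \<and> coprime2_on U P Q \<and> (\<exists>z\<in>U. Q z \<noteq> 0)"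

text \<open>
  Constancy of \<open>P / Q\<close> on \<open>V\<close> refers to the points where \<open>Q\<close> does not vanish, so that
  the convention \<open>x / 0 = 0\<close> plays no role.
\<close>

definition meromorphic_first_integral ::
    "(complex \<times> complex) set \<Rightarrow> (complex \<times> complex \<Rightarrow> complex \<times> complex) \<Rightarrow>
     (complex \<times> complex \<Rightarrow> complex) \<Rightarrow> (complex \<times> complex \<Rightarrow> complex) \<Rightarrow> bool"
  where "meromorphic_first_integral U F P Q \<longleftrightarrow>
    meromorphic2_on U P Q \<and>
    (\<forall>V. open V \<and> (0, 0) \<in> V \<and> V \<subseteq> U \<longrightarrow> \<not> (\<exists>c. \<forall>z\<in>V. Q z \<noteq> 0 \<longrightarrow> P z / Q z = c)) \<and>
    (\<forall>z\<in>U. F z \<in> U \<longrightarrow> P (F z) * Q z = P z * Q (F z))"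

end

theory Submission
  imports Defs "HOL-Complex_Analysis.Complex_Analysis"
begin

text \<open>
  Choose linear coordinates in which the differential of \<open>F\<close> at the origin is \<open>diag(\<lambda>, \<mu>)\<close>, and write
  the first integral as \<open>P / Q\<close>. The idea is to compare leading monomials in the identity
  \<open>P(F) Q = P Q(F)\<close>. When \<open>F\<close> multiplies leading monomials \<open>x\<^sup>k y\<^sup>i\<close> of \<open>P\<close> and \<open>x\<^sup>l y\<^sup>j\<close> of \<open>Q\<close> by the
  corresponding products of eigenvalues, these two products must agree. The agreement is a genuine resonance if
  \<open>(k, i) \<noteq> (l, j)\<close>, and this can be arranged: \<open>P - c Q\<close> over \<open>Q\<close> is also invariant, a suitable \<open>c\<close>
  removes the common leading monomial, and \<open>P - c Q\<close> is not zero since \<open>P / Q\<close> is not constant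
  (\<open>resonance_of_invariant_quotient\<close>).

  To treat both eigenvalue cases uniformly, blow up the origin by \<open>y = x \<eta>\<close>. The lift of \<open>F\<close> has the form
  \<open>(x, \<eta>) \<mapsto> (x g, h)\<close> with \<open>g = \<lambda>\<close> and \<open>h = \<nu> \<eta>\<close> on the divisor \<open>x = 0\<close>, where \<open>\<nu> = \<mu> / \<lambda>\<close>. Comparing
  monomials with the power of \<open>x\<close> first gives \<open>\<lambda>\<^sup>k \<nu>\<^sup>i = \<lambda>\<^sup>l \<nu>\<^sup>j\<close>. For \<open>\<mu> \<noteq> 0\<close> this is part (i).

  For \<open>\<mu> = 0\<close>, with \<open>0\<^sup>0 = 1\<close>, the relation is informative if the leading monomial of \<open>Q\<close> (or, by symmetry,
  of \<open>P\<close>) is a pure power of \<open>x\<close>: then \<open>\<lambda>\<^sup>k = \<lambda>\<^sup>l\<close> with \<open>k \<noteq> l\<close>. Otherwise blow up again, at the point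
  of the divisor to which the lifted map sends everything; the new lift is of the same kind
  (\<open>lift_divisor_map\<close>). It remains to see that some stage of this tower is good. If not, the strict
  transforms of both \<open>P = 0\<close> and \<open>Q = 0\<close> pass through all the centres, and then the two curves share a
  convergent branch (\<open>infinitely_near_common_zeros\<close>), contrary to coprimality. The convergence does not come
  from the dynamics, whose invariant curve is in general only formal, but from the curve \<open>P = 0\<close>: along
  the tower the order in \<open>y\<close> of its strict transform becomes stationary, say equal to \<open>e\<close>, and the derivative of order
  \<open>e - 1\<close> in \<open>y\<close> defines a smooth curve through all remaining centres, to which the implicit function
  theorem applies.

  The function theory needed for this consists of Osgood's lemma, division by a coordinate and holomorphy of partial
  derivatives, all obtained from the one-variable theory.
\<close>

section \<open>Complex differentiability in two variables\<close>

text \<open>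
  Real differentiability with a complex-linear differential. In this form the chain rule for maps of
  \<open>\<complex>\<^sup>2\<close> is immediate, which is what linear changes of coordinates, blow-ups and iterated lifts need;
  separate holomorphy would not give it.
\<close>

definition cdiff2 :: "(complex \<times> complex \<Rightarrow> complex) \<Rightarrow> complex \<times> complex \<Rightarrow> bool" where
  "cdiff2 f z \<longleftrightarrow> (\<exists>a b. (f has_derivative (\<lambda>w. a * fst w + b * snd w)) (at z))"

lemma cdiff2_const [simp]: "cdiff2 (\<lambda>z. c) z"
  unfolding cdiff2_def
  by (rule exI[of _ 0], rule exI[of _ 0]) (auto intro!: derivative_eq_intros)

lemma cdiff2_fst [simp]: "cdiff2 fst z"
  unfolding cdiff2_def
  by (rule exI[of _ 1], rule exI[of _ 0]) (auto intro!: derivative_eq_intros)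

lemma cdiff2_snd [simp]: "cdiff2 snd z"
  unfolding cdiff2_def
  by (rule exI[of _ 0], rule exI[of _ 1]) (auto intro!: derivative_eq_intros)

lemma cdiff2_add:
  assumes "cdiff2 f z" "cdiff2 g z"
  shows "cdiff2 (\<lambda>z. f z + g z) z"
proof -
  obtain a b c d where "(f has_derivative (\<lambda>w. a * fst w + b * snd w)) (at z)"
    "(g has_derivative (\<lambda>w. c * fst w + d * snd w)) (at z)"
    using assms by (auto simp: cdiff2_def)
  then have "((\<lambda>z. f z + g z) has_derivative (\<lambda>w. (a + c) * fst w + (b + d) * snd w)) (at z)"
    by (auto intro!: derivative_eq_intros simp: algebra_simps)
  then show ?thesis by (auto simp: cdiff2_def)
qed

lemma cdiff2_mult:
  assumes "cdiff2 f z" "cdiff2 g z"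
  shows "cdiff2 (\<lambda>z. f z * g z) z"
proof -
  obtain a b c d where "(f has_derivative (\<lambda>w. a * fst w + b * snd w)) (at z)"
    "(g has_derivative (\<lambda>w. c * fst w + d * snd w)) (at z)"
    using assms by (auto simp: cdiff2_def)
  then have "((\<lambda>z. f z * g z) has_derivative
      (\<lambda>w. (f z * c + a * g z) * fst w + (f z * d + b * g z) * snd w)) (at z)"
    by (auto intro!: derivative_eq_intros simp: algebra_simps)
  then show ?thesis unfolding cdiff2_def by blast
qed

lemma cdiff2_diff:
  assumes "cdiff2 f z" "cdiff2 g z"
  shows "cdiff2 (\<lambda>z. f z - g z) z"
  using cdiff2_add[OF assms(1) cdiff2_mult[OF cdiff2_const[of "-1"] assms(2)]] by simp

lemma cdiff2_holomorphic_compose: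
  assumes "cdiff2 f z" "g field_differentiable (at (f z))"
  shows "cdiff2 (\<lambda>z. g (f z)) z"
proof -
  obtain a b where f: "(f has_derivative (\<lambda>w. a * fst w + b * snd w)) (at z)"
    using assms by (auto simp: cdiff2_def)
  obtain c where "(g has_field_derivative c) (at (f z))"
    using assms by (auto simp: field_differentiable_def)
  then have "(g has_derivative (\<lambda>h. c * h)) (at (f z))"
    by (simp add: has_field_derivative_def)
  from diff_chain_at[OF f this]
  have "((\<lambda>z. g (f z)) has_derivative (\<lambda>w. (c * a) * fst w + (c * b) * snd w)) (at z)"
    by (simp add: o_def algebra_simps)
  then show ?thesis unfolding cdiff2_def by blast
qed

lemma cdiff2_inverse:
  assumes "cdiff2 f z" "f z \<noteq> 0"
  shows "cdiff2 (\<lambda>z. inverse (f z)) z"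
  using cdiff2_holomorphic_compose[OF assms(1) field_differentiable_inverse[OF field_differentiable_ident, of "f z"]] assms(2)
  by simp

lemma cdiff2_divide:
  assumes "cdiff2 f z" "cdiff2 g z" "g z \<noteq> 0"
  shows "cdiff2 (\<lambda>z. f z / g z) z"
  using cdiff2_mult[OF assms(1) cdiff2_inverse[OF assms(2,3)]] by (simp add: divide_inverse)

lemma cdiff2_power: "cdiff2 f z \<Longrightarrow> cdiff2 (\<lambda>z. f z ^ n) z"
  by (induction n) (auto intro: cdiff2_mult)

lemma cdiff2_compose:
  assumes "cdiff2 u z" "cdiff2 v z" "cdiff2 f (u z, v z)"
  shows "cdiff2 (\<lambda>z. f (u z, v z)) z"
proof -
  obtain a b where u: "(u has_derivative (\<lambda>w. a * fst w + b * snd w)) (at z)"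
    using assms by (auto simp: cdiff2_def)
  obtain c d where v: "(v has_derivative (\<lambda>w. c * fst w + d * snd w)) (at z)"
    using assms by (auto simp: cdiff2_def)
  obtain p q where f: "(f has_derivative (\<lambda>w. p * fst w + q * snd w)) (at (u z, v z))"
    using assms by (auto simp: cdiff2_def)
  from diff_chain_at[OF has_derivative_Pair[OF u v] f]
  have "((\<lambda>z. f (u z, v z)) has_derivative
      (\<lambda>w. (p * a + q * c) * fst w + (p * b + q * d) * snd w)) (at z)"
    by (simp add: o_def algebra_simps)
  then show ?thesis unfolding cdiff2_def by blast
qed

lemma cdiff2_imp_isCont: "cdiff2 f z \<Longrightarrow> isCont f z"
  by (auto simp: cdiff2_def intro: has_derivative_continuous)

lemma has_derivative_partials:
  assumes "(f has_derivative (\<lambda>w. a * fst w + b * snd w)) (at (x, y))"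
  shows "((\<lambda>x. f (x, y)) has_field_derivative a) (at x)"
    and "((\<lambda>y. f (x, y)) has_field_derivative b) (at y)"
proof -
  have "((\<lambda>x. (x, y)) has_derivative (\<lambda>h. (h, 0))) (at x)"
    by (auto intro!: derivative_eq_intros)
  from diff_chain_at[OF this assms] show "((\<lambda>x. f (x, y)) has_field_derivative a) (at x)"
    by (simp add: o_def has_field_derivative_def)
  have "((\<lambda>y. (x, y)) has_derivative (\<lambda>h. (0, h))) (at y)"
    by (auto intro!: derivative_eq_intros)
  from diff_chain_at[OF this assms] show "((\<lambda>y. f (x, y)) has_field_derivative b) (at y)"
    by (simp add: o_def has_field_derivative_def)
qed

lemma cdiff2_imp_partial:
  assumes "cdiff2 f (x, y)"
  shows "(\<lambda>x. f (x, y)) field_differentiable (at x)" "(\<lambda>y. f (x, y)) field_differentiable (at y)"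
  using assms has_derivative_partials unfolding cdiff2_def field_differentiable_def by blast+

lemma cdiff2_swap: "cdiff2 (\<lambda>z. f (snd z, fst z)) (y, x)" if "cdiff2 f (x, y)"
  by (rule cdiff2_compose) (use that in auto)

definition holo2_on :: "(complex \<times> complex \<Rightarrow> complex) \<Rightarrow> (complex \<times> complex) set \<Rightarrow> bool" 
  where "holo2_on f W \<longleftrightarrow> (\<forall>z\<in>W. cdiff2 f z)"

lemma holo2_on_subset: "holo2_on f W \<Longrightarrow> V \<subseteq> W \<Longrightarrow> holo2_on f V"
  by (auto simp: holo2_on_def)

lemma holo2_on_imp_continuous_on: "holo2_on f W \<Longrightarrow> continuous_on W f"
  by (auto simp: holo2_on_def intro: continuous_at_imp_continuous_on cdiff2_imp_isCont)

lemma holo2_on_slices: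
  assumes "holo2_on f (A \<times> B)" "open A" "open B"
  shows "y \<in> B \<Longrightarrow> (\<lambda>x. f (x, y)) holomorphic_on A" "x \<in> A \<Longrightarrow> (\<lambda>y. f (x, y)) holomorphic_on B"
  using assms cdiff2_imp_partial
  by (fastforce simp: holo2_on_def holomorphic_on_open field_differentiable_def)+

lemma isCont_iff_tendsto_nhds: "isCont f a \<longleftrightarrow> (f \<longlongrightarrow> f a) (nhds a)"
  by (simp add: isCont_def tendsto_at_iff_tendsto_nhds)

text \<open>
  At a point \<open>(a, b)\<close> the terms of total degree at least two form an absolutely convergent series, and
  shrinking the polydisc by a factor \<open>q\<close> shrinks their sum by at least \<open>q\<^sup>2\<close>. Hence the linear part of
  the expansion is the differential. Every point of the domain has its own expansion, so
  looking at the centres is enough.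
\<close>

lemma analytic2_on_imp_holo2_on:
  assumes "f analytic2_on U"
  shows "holo2_on f U"
proof -
  have "cdiff2 f (a, b)" if ab: "(a, b) \<in> U" for a b
  proof -
    have "\<exists>r>0. \<exists>c. \<forall>x\<in>ball a r. \<forall>y\<in>ball b r.
        ((\<lambda>(i, j). c i j * (x - a) ^ i * (y - b) ^ j) has_sum f (x, y)) UNIV"
      using bspec[OF assms[unfolded analytic2_on_def] ab] by simp
    then obtain r c where r: "r > 0" and sums: "\<forall>x\<in>ball a r. \<forall>y\<in>ball b r.
        ((\<lambda>(i, j). c i j * (x - a) ^ i * (y - b) ^ j) has_sum f (x, y)) UNIV"
      by (elim exE conjE)
    note sum = sums[rule_format]
    define \<rho> where "\<rho> = r / 2"
    have \<rho>: "0 < \<rho>" "\<rho> < r" using r by (auto simp: \<rho>_def)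
    define M where "M = (\<lambda>(i, j). norm (c i j) * \<rho> ^ (i + j))"
    have "(\<lambda>(i, j). c i j * (a + of_real \<rho> - a) ^ i * (b + of_real \<rho> - b) ^ j) summable_on UNIV"
      by (rule has_sum_imp_summable[OF sum]) (use \<rho> in \<open>auto simp: dist_norm\<close>)
    then have "(\<lambda>z. norm (case z of (i, j) \<Rightarrow> c i j * (a + of_real \<rho> - a) ^ i * (b + of_real \<rho> - b) ^ j)) summable_on UNIV"
      by (simp only: summable_on_iff_abs_summable_on_complex)
    then have "M summable_on UNIV"
      using \<rho> by (simp add: M_def case_prod_unfold norm_mult norm_power power_add mult.assoc)
    then obtain T where T: "(M has_sum T) UNIV" using has_sum_infsum by blast
    define K where "K = T / \<rho>\<^sup>2"
    let ?L = "\<lambda>w. c 1 0 * fst w + c 0 1 * snd w"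
    have main: "norm (f ((a, b) + w) - c 0 0 - ?L w) \<le> K * (norm w)\<^sup>2" if w: "norm w < \<rho>" for w
    proof -
      let ?h = "fst w" and ?k = "snd w"
      have hk: "norm ?h \<le> norm w" "norm ?k \<le> norm w" using norm_fst_le norm_snd_le by (metis prod.collapse)+
      define B where "B = {(0, 0), (1, 0), (0 :: nat, 1 :: nat)}"
      define t where "t = (\<lambda>(i, j). c i j * ?h ^ i * ?k ^ j)"
      have "(t has_sum f (a + ?h, b + ?k)) UNIV"
        using sum[of "a + ?h" "b + ?k"] hk w \<rho> by (simp add: t_def dist_norm)
      \<comment> \<open>Cancels the three terms of degree at most one, which form the affine part.\<close>
      moreover have "((\<lambda>z. if z \<in> B then - t z else 0) has_sum (\<Sum>z\<in>B. - t z)) UNIV"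
        by (rule has_sum_finite_neutralI[of B]) (auto simp: B_def)
      ultimately have "((\<lambda>z. t z + (if z \<in> B then - t z else 0)) has_sum f (a + ?h, b + ?k) + (\<Sum>z\<in>B. - t z)) UNIV"
        by (rule has_sum_add)
      moreover have "((\<lambda>z. (norm w / \<rho>)\<^sup>2 * M z) has_sum (norm w / \<rho>)\<^sup>2 * T) UNIV"
        by (rule has_sum_cmult_right[OF T])
      moreover have "norm (t z + (if z \<in> B then - t z else 0)) \<le> (norm w / \<rho>)\<^sup>2 * M z" for z
      proof (cases "z \<in> B")
        case True
        have "M z \<ge> 0" using \<rho> by (simp add: M_def case_prod_unfold)
        then show ?thesis using True by simp
      next
        case False
        obtain i j where z: "z = (i, j)" by force
        have "i + j \<ge> 2" using False by (cases i; cases j) (auto simp: B_def z)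
        have "norm (t z) = norm (c i j) * (norm ?h ^ i * norm ?k ^ j)"
          by (simp add: t_def z norm_mult norm_power)
        also have "\<dots> \<le> norm (c i j) * (norm w ^ i * norm w ^ j)"
          using hk by (intro mult_left_mono mult_mono power_mono) auto
        also have "norm w ^ i * norm w ^ j = (norm w / \<rho>) ^ (i + j) * \<rho> ^ (i + j)"
          using \<rho> by (simp add: power_divide power_add)
        also have "norm (c i j) * ((norm w / \<rho>) ^ (i + j) * \<rho> ^ (i + j))
            \<le> norm (c i j) * ((norm w / \<rho>)\<^sup>2 * \<rho> ^ (i + j))"
          using \<rho> w \<open>i + j \<ge> 2\<close> by (intro mult_left_mono mult_right_mono power_decreasing) auto
        finally show ?thesis using False by (simp add: M_def z mult_ac)
      qed
      ultimately have "norm (f (a + ?h, b + ?k) + (\<Sum>z\<in>B. - t z)) \<le> (norm w / \<rho>)\<^sup>2 * T"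
        by (rule norm_infsum_le)
      moreover have "f (a + ?h, b + ?k) + (\<Sum>z\<in>B. - t z) = f ((a, b) + w) - c 0 0 - ?L w"
        by (simp add: B_def t_def plus_prod_def)
      ultimately show ?thesis by (simp add: K_def power_divide mult_ac)
    qed
    from main[of 0] \<rho> have fab: "f (a, b) = c 0 0" by simp
    have "(f has_derivative ?L) (at (a, b))"
    proof (rule has_derivativeI_sandwich[OF \<rho>(1)])
      show "bounded_linear ?L"
        by (intro bounded_linear_add bounded_linear_mult_const bounded_linear_const_mult bounded_linear_fst bounded_linear_snd)
      show "norm (f y - f (a, b) - ?L (y - (a, b))) / norm (y - (a, b)) \<le> K * norm (y - (a, b))"
        if "y \<noteq> (a, b)" "dist y (a, b) < \<rho>" for y
        using main[of "y - (a, b)"] that fab by (simp add: dist_norm pos_divide_le_eq power2_eq_square mult.assoc)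
      have "((\<lambda>y. K * norm (y - (a, b))) \<longlongrightarrow> K * norm ((a, b) - (a, b))) (at (a, b))"
        by (intro tendsto_intros)
      then show "((\<lambda>y. K * norm (y - (a, b))) \<longlongrightarrow> 0) (at (a, b))" by simp
    qed
    then show ?thesis unfolding cdiff2_def by blast
  qed
  then show ?thesis by (auto simp: holo2_on_def)
qed

section \<open>Osgood's lemma\<close>

definition Dy :: "(complex \<times> complex \<Rightarrow> complex) \<Rightarrow> complex \<times> complex \<Rightarrow> complex" where
  "Dy f z = deriv (\<lambda>y. f (fst z, y)) (snd z)"

text \<open>
  Continuity in the parameter \<open>x\<close>: by compactness \<open>f (x, \<cdot>)\<close> is uniformly close to \<open>f (x0, \<cdot>)\<close> on a
  fixed disc, and Cauchy's inequality turns this into closeness of the derivatives.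
\<close>

lemma continuous_on_Dy:
  assumes "open A" "open B" "continuous_on (A \<times> B) f"
    and hol: "\<And>x. x \<in> A \<Longrightarrow> (\<lambda>y. f (x, y)) holomorphic_on B"
  shows "continuous_on (A \<times> B) (Dy f)"
proof -
  have "isCont (Dy f) (x0, y0)" if "x0 \<in> A" "y0 \<in> B" for x0 y0
  proof -
    obtain \<rho> where \<rho>: "\<rho> > 0" "cball y0 (2*\<rho>) \<subseteq> B"
    proof -
      obtain e where e: "e > 0" "cball y0 e \<subseteq> B"
        using \<open>open B\<close> \<open>y0 \<in> B\<close> open_contains_cball by blast
      show thesis using that[of "e/2"] e by simp
    qed
    have in_B: "w \<in> B" "w \<in> cball y0 (2*\<rho>)" if "y \<in> ball y0 \<rho>" "w \<in> cball y \<rho>" for y w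
    proof -
      have "dist y0 w \<le> dist y0 y + dist y w" by (rule dist_triangle)
      then show "w \<in> cball y0 (2*\<rho>)" using that by auto
      then show "w \<in> B" using \<rho> by auto
    qed
    have "(Dy f \<longlongrightarrow> Dy f (x0, y0)) (nhds (x0, y0))"
    proof (rule tendstoI)
      fix e :: real assume e: "e > 0"
      have cont: "continuous_on (A \<times> cball y0 (2*\<rho>)) f"
        by (rule continuous_on_subset[OF assms(3)]) (use \<rho> in auto)
      obtain X0 where X0: "x0 \<in> X0" "open X0"
        "\<forall>x\<in>X0 \<inter> A. \<forall>t\<in>cball y0 (2*\<rho>). dist (f (x, t)) (f (x0, t)) \<le> e * \<rho> / 2"
        by (rule continuous_on_prod_compactE[OF cont _ \<open>x0 \<in> A\<close>, of "e * \<rho> / 2"]) (use e \<rho> in auto)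
      have near: "dist (Dy f (x, y)) (Dy f (x0, y)) \<le> e / 2" 
        if x: "x \<in> X0 \<inter> A" and y: "y \<in> ball y0 \<rho>" for x y
      proof -
        have y_B: "y \<in> B" using in_B[OF y] \<rho> by auto
        let ?g = "\<lambda>w. f (x, w) - f (x0, w)"
        have sub: "cball y \<rho> \<subseteq> B" using in_B[OF y] by blast
        have holg: "?g holomorphic_on B" 
          using hol x \<open>x0 \<in> A\<close> by (auto intro: holomorphic_intros)
        have "norm ((deriv ^^ 1) ?g y) \<le> fact 1 * (e * \<rho> / 2) / \<rho> ^ 1"
        proof (rule Cauchy_inequality)
          show "?g holomorphic_on ball y \<rho>" "continuous_on (cball y \<rho>) ?g"
            using holg sub ball_subset_cball by (blast intro: holomorphic_on_subset holomorphic_on_imp_continuous_on)+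
          fix w assume "norm (y - w) = \<rho>"
          then have "w \<in> cball y0 (2*\<rho>)" using in_B[OF y] by (simp add: dist_norm)
          then show "norm (?g w) \<le> e * \<rho> / 2" using X0 x by (auto simp: dist_norm)
        qed (use \<rho> in auto)
        moreover have "deriv ?g y = deriv (\<lambda>w. f (x, w)) y - deriv (\<lambda>w. f (x0, w)) y"
          using hol x \<open>x0 \<in> A\<close> y_B \<open>open B\<close>
          by (intro deriv_diff) (auto simp: holomorphic_on_open field_differentiable_def)
        ultimately show ?thesis using \<rho> by (simp add: Dy_def dist_norm)
      qed
      have "(\<lambda>y. Dy f (x0, y)) holomorphic_on B"
        using hol \<open>x0 \<in> A\<close> \<open>open B\<close> by (auto simp: Dy_def intro: holomorphic_deriv)
      then have "isCont (\<lambda>y. Dy f (x0, y)) y0"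
        using \<open>open B\<close> \<open>y0 \<in> B\<close> continuous_on_eq_continuous_at holomorphic_on_imp_continuous_on by blast
      then have "((\<lambda>y. Dy f (x0, y)) \<longlongrightarrow> Dy f (x0, y0)) (nhds y0)"
        using isCont_iff_tendsto_nhds by blast
      then have "\<forall>\<^sub>F y in nhds y0. dist (Dy f (x0, y)) (Dy f (x0, y0)) < e / 2"
        by (rule tendstoD) (use e in simp)
      moreover have "\<forall>\<^sub>F y in nhds y0. y \<in> ball y0 \<rho>"
        using \<rho> by (intro eventually_nhds_in_open) auto
      moreover have "\<forall>\<^sub>F x in nhds x0. x \<in> X0 \<inter> A"
        using X0 \<open>x0 \<in> A\<close> \<open>open A\<close> by (intro eventually_nhds_in_open) auto
      ultimately have "\<forall>\<^sub>F z in nhds x0 \<times>\<^sub>F nhds y0. fst z \<in> X0 \<inter> A \<and>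
           (dist (Dy f (x0, snd z)) (Dy f (x0, y0)) < e / 2 \<and> snd z \<in> ball y0 \<rho>)"
        unfolding eventually_prod_filter
        by (intro exI[of _ "\<lambda>x. x \<in> X0 \<inter> A"]
            exI[of _ "\<lambda>y. dist (Dy f (x0, y)) (Dy f (x0, y0)) < e / 2 \<and> y \<in> ball y0 \<rho>"])
          (auto intro: eventually_conj)
      then show "\<forall>\<^sub>F z in nhds (x0, y0). dist (Dy f z) (Dy f (x0, y0)) < e"
        unfolding nhds_prod
      proof eventually_elim
        case (elim z)
        then have "dist (Dy f z) (Dy f (x0, snd z)) \<le> e / 2"
          using near[of "fst z" "snd z"] by auto
        then show ?case using elim dist_triangle[of "Dy f z" "Dy f (x0, y0)" "Dy f (x0, snd z)"] by linarith
      qed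
    qed
    then show ?thesis by (simp add: isCont_iff_tendsto_nhds)
  qed
  then show ?thesis by (auto intro: continuous_at_imp_continuous_on)
qed

text \<open>
  One continuous partial derivative suffices for total differentiability, and the previous lemma
  provides it. Functions constructed below by a quotient or as a partial derivative are only visibly
  continuous and separately holomorphic; this is how they re-enter the calculus of total differentials.
\<close>

theorem osgood:
  assumes "open A" "open B" and cont: "continuous_on (A \<times> B) f"
    and holx: "\<And>y. y \<in> B \<Longrightarrow> (\<lambda>x. f (x, y)) holomorphic_on A"
    and holy: "\<And>x. x \<in> A \<Longrightarrow> (\<lambda>y. f (x, y)) holomorphic_on B"
  shows "holo2_on f (A \<times> B)"
proof -
  have "cdiff2 f (x0, y0)" if z: "x0 \<in> A" "y0 \<in> B" for x0 y0
  proof -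
    obtain e where e: "e > 0" "ball y0 e \<subseteq> B"
      using \<open>open B\<close> z open_contains_ball by blast
    have der_y: "((\<lambda>y. f (x, y)) has_field_derivative Dy f (x, y)) (at y)" if "x \<in> A" "y \<in> B" for x y
      using holy[OF that(1)] that \<open>open B\<close> by (simp add: Dy_def holomorphic_derivI)
    have der_x: "((\<lambda>x. f (x, y0)) has_field_derivative deriv (\<lambda>x. f (x, y0)) x0) (at x0)"
      using holx[OF z(2)] z \<open>open A\<close> by (simp add: holomorphic_derivI)
    have "continuous_on (A \<times> B) (Dy f)"
      by (rule continuous_on_Dy) (use assms in auto)
    then have contD: "isCont (Dy f) (x0, y0)"
      using z assms by (simp add: continuous_on_eq_continuous_at open_Times)
    have "((\<lambda>(x, y). f (x, y)) has_derivative
       (\<lambda>(tx, ty). deriv (\<lambda>x. f (x, y0)) x0 * tx + blinfun_apply (blinfun_mult_right (Dy f (x0, y0))) ty))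
       (at (x0, y0) within A \<times> ball y0 e)"
    proof (rule has_derivative_partialsI)
      show "((\<lambda>x. f (x, y0)) has_derivative (\<lambda>tx. deriv (\<lambda>x. f (x, y0)) x0 * tx)) (at x0 within A)"
        by (rule has_derivative_at_withinI) (use der_x in \<open>simp add: has_field_derivative_def\<close>)
      show "((\<lambda>y. f (x, y)) has_derivative blinfun_apply (blinfun_mult_right (Dy f (x, y))))
         (at y within ball y0 e)" if "x \<in> A" "y \<in> ball y0 e" for x y
      proof -
        have "((\<lambda>y. f (x, y)) has_field_derivative Dy f (x, y)) (at y)"
          using der_y that e by blast
        then have "((\<lambda>y. f (x, y)) has_derivative blinfun_apply (blinfun_mult_right (Dy f (x, y)))) (at y)"
          by (simp add: has_field_derivative_def)
        then show ?thesis by (rule has_derivative_at_withinI)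
      qed
      show "continuous (at (x0, y0) within A \<times> ball y0 e) (\<lambda>(x, y). blinfun_mult_right (Dy f (x, y)))"
      proof -
        have "continuous (at (x0, y0) within A \<times> ball y0 e) (\<lambda>z. blinfun_mult_right (Dy f z))"
          by (rule bounded_linear.continuous[OF bounded_linear_blinfun_mult_right
                continuous_at_imp_continuous_at_within[OF contD]])
        then show ?thesis by (simp add: case_prod_unfold)
      qed
    qed (use e z in auto)
    then have "(f has_derivative (\<lambda>w. deriv (\<lambda>x. f (x, y0)) x0 * fst w + Dy f (x0, y0) * snd w))
       (at (x0, y0) within A \<times> ball y0 e)"
      by (simp add: case_prod_unfold)
    moreover have "at (x0, y0) within A \<times> ball y0 e = at (x0, y0)"
      using z e assms by (intro at_within_open) (auto intro: open_Times)
    ultimately show ?thesis unfolding cdiff2_def by auto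
  qed
  then show ?thesis by (auto simp: holo2_on_def)
qed

section \<open>Division by a coordinate and partial derivatives\<close>

text \<open>
  On each line \<open>y = const\<close> the quotient extends over \<open>x = 0\<close> by Riemann's theorem. The extension depends
  continuously on \<open>y\<close>, uniformly on discs in \<open>x\<close>, because the maximum principle reduces the estimate to
  a circle \<open>|x| = \<rho>\<close>, where the denominator has constant modulus. On the line \<open>x = 0\<close> the
  quotient is then a locally uniform limit of holomorphic functions of \<open>y\<close>.
  The radius does not shrink, so the division may be iterated.
\<close>

lemma holo2_on_divide_fst:
  assumes r: "r > 0" and V: "open V" and f: "holo2_on f (ball 0 r \<times> V)"
    and zero: "\<And>y. y \<in> V \<Longrightarrow> f (0, y) = 0"
  obtains g where "holo2_on g (ball 0 r \<times> V)" 
    "\<And>x y. x \<in> ball 0 r \<Longrightarrow> y \<in> V \<Longrightarrow> f (x, y) = x * g (x, y)"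
proof -
  define g where "g z = (if fst z = 0 then deriv (\<lambda>x. f (x, snd z)) 0 else f z / fst z)" for z
  note slices = holo2_on_slices[OF f open_ball V]
  have holx: "(\<lambda>x. g (x, y)) holomorphic_on ball 0 r" if "y \<in> V" for y
    using pole_lemma_open[OF slices(1)[OF that] open_ball, of 0] zero[OF that]
    by (simp add: g_def if_distrib cong: if_cong)
  have contf: "continuous_on (V \<times> ball 0 r) (\<lambda>z. f (snd z, fst z))"
    by (rule continuous_on_compose2[OF holo2_on_imp_continuous_on[OF f]])
      (auto intro!: continuous_intros)
  have equi: "\<exists>Y0. open Y0 \<and> y0 \<in> Y0 \<and>
      (\<forall>y\<in>Y0 \<inter> V. \<forall>x\<in>cball 0 \<rho>. dist (g (x, y)) (g (x, y0)) \<le> e)"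
    if y0: "y0 \<in> V" and \<rho>: "0 < \<rho>" "\<rho> < r" and e: "e > 0" for y0 \<rho> e
  proof -
    have cont: "continuous_on (V \<times> cball 0 \<rho>) (\<lambda>z. f (snd z, fst z))"
      by (rule continuous_on_subset[OF contf]) (use \<rho> in auto)
    obtain Y0 where Y0: "y0 \<in> Y0" "open Y0"
      "\<forall>y\<in>Y0 \<inter> V. \<forall>x\<in>cball 0 \<rho>. dist (f (x, y)) (f (x, y0)) \<le> e * \<rho>"
      using continuous_on_prod_compactE[OF cont compact_cball y0, of "e * \<rho>"] e \<rho>
      by (simp only: fst_conv snd_conv mult_pos_pos) blast
    have "dist (g (x, y)) (g (x, y0)) \<le> e" if y: "y \<in> Y0 \<inter> V" and x: "x \<in> cball 0 \<rho>" for x y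
    proof -
      have hol: "(\<lambda>x. g (x, y) - g (x, y0)) holomorphic_on ball 0 r"
        using holx y y0 by (auto intro: holomorphic_intros)
      have "norm (g (x, y) - g (x, y0)) \<le> e"
      proof (rule maximum_modulus_frontier[of "\<lambda>x. g (x, y) - g (x, y0)" "cball 0 \<rho>"])
        show "(\<lambda>x. g (x, y) - g (x, y0)) holomorphic_on interior (cball 0 \<rho>)"
          by (rule holomorphic_on_subset[OF hol]) (use \<rho> in auto)
        show "continuous_on (closure (cball 0 \<rho>)) (\<lambda>x. g (x, y) - g (x, y0))"
          by (rule holomorphic_on_imp_continuous_on, rule holomorphic_on_subset[OF hol]) (use \<rho> in auto)
        fix w :: complex assume "w \<in> frontier (cball 0 \<rho>)"
        then have w: "norm w = \<rho>" using \<rho> by simp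
        then have "dist (f (w, y)) (f (w, y0)) \<le> e * \<rho>" "w \<noteq> 0" using Y0 y \<rho> by auto
        then show "norm (g (w, y) - g (w, y0)) \<le> e"
          using w \<rho> by (simp add: g_def dist_norm norm_divide divide_simps flip: diff_divide_distrib)
      qed (use x in auto)
      then show ?thesis by (simp add: dist_norm)
    qed
    then show ?thesis using Y0 by blast
  qed
  have contg: "continuous_on (ball 0 r \<times> V) g"
  proof -
    have "isCont g (x0, y0)" if z: "x0 \<in> ball 0 r" "y0 \<in> V" for x0 y0
      unfolding isCont_iff_tendsto_nhds
    proof (rule tendstoI)
      fix e :: real assume e: "e > 0"
      obtain \<rho> where \<rho>: "norm x0 < \<rho>" "\<rho> < r" using z dense by auto
      then have "\<rho> > 0" using norm_ge_zero[of x0] by linarith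
      obtain Y0 where Y0: "open Y0" "y0 \<in> Y0"
        "\<forall>y\<in>Y0 \<inter> V. \<forall>x\<in>cball 0 \<rho>. dist (g (x, y)) (g (x, y0)) \<le> e / 2"
        using equi[OF z(2) \<open>\<rho> > 0\<close> \<rho>(2), of "e / 2"] e by auto
      have "isCont (\<lambda>x. g (x, y0)) x0"
        using holx[OF z(2)] z(1) holomorphic_on_imp_continuous_on continuous_on_eq_continuous_at open_ball by blast
      then have "((\<lambda>x. g (x, y0)) \<longlongrightarrow> g (x0, y0)) (nhds x0)"
        using isCont_iff_tendsto_nhds by blast
      then have "\<forall>\<^sub>F x in nhds x0. dist (g (x, y0)) (g (x0, y0)) < e / 2"
        by (rule tendstoD) (use e in simp)
      moreover have "\<forall>\<^sub>F x in nhds x0. x \<in> ball 0 \<rho>"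
        using \<rho> by (intro eventually_nhds_in_open) auto
      moreover have "\<forall>\<^sub>F y in nhds y0. y \<in> Y0 \<inter> V"
        using Y0 V z by (intro eventually_nhds_in_open) auto
      ultimately have "\<forall>\<^sub>F z in nhds x0 \<times>\<^sub>F nhds y0. (dist (g (fst z, y0)) (g (x0, y0)) < e / 2 \<and>
          fst z \<in> ball 0 \<rho>) \<and> snd z \<in> Y0 \<inter> V"
        unfolding eventually_prod_filter
        by (intro exI[of _ "\<lambda>x. dist (g (x, y0)) (g (x0, y0)) < e / 2 \<and> x \<in> ball 0 \<rho>"]
            exI[of _ "\<lambda>y. y \<in> Y0 \<inter> V"]) (auto intro: eventually_conj)
      then show "\<forall>\<^sub>F z in nhds (x0, y0). dist (g z) (g (x0, y0)) < e"
        unfolding nhds_prod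
      proof eventually_elim
        case (elim z)
        have "dist (g z) (g (fst z, y0)) \<le> e / 2"
          using Y0(3)[rule_format, of "snd z" "fst z"] elim by auto
        then show ?case using elim dist_triangle[of "g z" "g (x0, y0)" "g (fst z, y0)"] by linarith
      qed
    qed
    then show ?thesis by (auto intro: continuous_at_imp_continuous_on)
  qed
  have holy: "(\<lambda>y. g (x, y)) holomorphic_on V" if x: "x \<in> ball 0 r" for x
  proof (cases "x = 0")
    case False
    then have "(\<lambda>y. g (x, y)) = (\<lambda>y. f (x, y) / x)" by (simp add: g_def fun_eq_iff)
    then show ?thesis using slices(2)[OF x] False by (auto intro: holomorphic_intros)
  next
    case True
    \<comment> \<open>Approach the line \<open>x = 0\<close> through lines on which \<open>g\<close> is a plain quotient.\<close>
    define t :: "nat \<Rightarrow> complex" where "t n = of_real (r / (real n + 2))" for n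
    have t0: "t n \<noteq> 0" for n unfolding t_def of_real_eq_0_iff using r by simp
    have tr: "t n \<in> ball 0 r" for n
      using r by (simp add: t_def norm_divide divide_simps add_pos_nonneg flip: of_real_divide)
    have "(\<lambda>n. r / (real n + 2)) \<longlonglongrightarrow> 0" by real_asymp
    from tendsto_of_real[OF this, where 'a = complex] have t: "t \<longlonglongrightarrow> 0"
      by (simp add: t_def[abs_def] del: of_real_divide)
    have "(\<lambda>y. g (0, y)) holomorphic_on V"
    proof (rule holomorphic_uniform_sequence[OF V])
      show "(\<lambda>y. g (t n, y)) holomorphic_on V" for n
      proof -
        have "(\<lambda>y. g (t n, y)) = (\<lambda>y. f (t n, y) / t n)" by (simp add: g_def fun_eq_iff t0)
        then show ?thesis using slices(2)[OF tr] t0 by (auto intro: holomorphic_intros)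
      qed
      fix y assume "y \<in> V"
      then obtain d where d: "d > 0" "cball y d \<subseteq> V" using V open_contains_cball by blast
      have "uniform_limit (cball y d) (\<lambda>n y. g (t n, y)) (\<lambda>y. g (0, y)) sequentially"
        unfolding uniform_limit_iff
      proof safe
        fix e :: real assume e: "e > 0"
        have cont: "continuous_on (ball 0 r \<times> cball y d) g"
          by (rule continuous_on_subset[OF contg]) (use d in auto)
        obtain X0 where X0: "0 \<in> X0" "open X0"
          "\<forall>x\<in>X0 \<inter> ball 0 r. \<forall>s\<in>cball y d. dist (g (x, s)) (g (0, s)) \<le> e / 2"
          by (rule continuous_on_prod_compactE[OF cont compact_cball, of 0 "e / 2"]) (use e r in auto)
        have "\<forall>\<^sub>F n in sequentially. t n \<in> X0" 
          using t X0 by (metis topological_tendstoD)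
        then show "\<forall>\<^sub>F n in sequentially. \<forall>s\<in>cball y d. dist (g (t n, s)) (g (0, s)) < e"
        proof eventually_elim
          case (elim n)
          show ?case
          proof
            fix s assume "s \<in> cball y d"
            then have "dist (g (t n, s)) (g (0, s)) \<le> e / 2" using X0(3) elim tr by blast
            then show "dist (g (t n, s)) (g (0, s)) < e" using e by linarith
          qed
        qed
      qed
      then show "\<exists>d>0. cball y d \<subseteq> V \<and> uniform_limit (cball y d) (\<lambda>n y. g (t n, y)) (\<lambda>y. g (0, y)) sequentially"
        using d by blast
    qed
    then show ?thesis using True by simp
  qed
  have "holo2_on g (ball 0 r \<times> V)"
    by (rule osgood[OF open_ball V contg holx holy])
  moreover have "f (x, y) = x * g (x, y)" if "y \<in> V" for x y
    using zero[OF that] by (auto simp: g_def)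
  ultimately show thesis using that by blast
qed

text \<open>
  Only holomorphy in \<open>x\<close> is at stake. The increment \<open>f (x, y + h) - f (x, y)\<close> is divisible by \<open>h\<close>, and
  the quotient at \<open>h = 0\<close> is the partial derivative.
\<close>

lemma holo2_on_Dy:
  assumes A: "open A" and B: "open B" and f: "holo2_on f (A \<times> B)"
  shows "holo2_on (Dy f) (A \<times> B)"
proof (rule osgood[OF A B])
  note slices = holo2_on_slices[OF f A B]
  show "continuous_on (A \<times> B) (Dy f)"
    by (rule continuous_on_Dy[OF A B holo2_on_imp_continuous_on[OF f] slices(2)])
  show "(\<lambda>y. Dy f (x, y)) holomorphic_on B" if "x \<in> A" for x
    using slices(2)[OF that] B by (simp add: Dy_def holomorphic_deriv)
  show "(\<lambda>x. Dy f (x, y)) holomorphic_on A" if y: "y \<in> B" for y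
  proof -
    obtain e where e: "e > 0" "ball y e \<subseteq> B" using B y open_contains_ball by blast
    define F where "F = (\<lambda>z. f (snd z, y + fst z) - f (snd z, y))"
    have "cdiff2 F (h, x)" if "h \<in> ball 0 e" "x \<in> A" for h x
    proof -
      have "y + h \<in> B" using e that by (auto simp: dist_norm subset_iff)
      then have "cdiff2 f (x, y + h)" "cdiff2 f (x, y)" using f that y by (auto simp: holo2_on_def)
      then show ?thesis unfolding F_def
        using cdiff2_compose[of snd "(h, x)" "\<lambda>z. y + fst z" f] 
          cdiff2_compose[of snd "(h, x)" "\<lambda>z. y" f] cdiff2_add[of "\<lambda>z. y" "(h, x)" fst]
        by (intro cdiff2_diff) simp_all
    qed
    then have F: "holo2_on F (ball 0 e \<times> A)" by (auto simp: holo2_on_def)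
    obtain g where g: "holo2_on g (ball 0 e \<times> A)"
      "\<And>h x. h \<in> ball 0 e \<Longrightarrow> x \<in> A \<Longrightarrow> F (h, x) = h * g (h, x)"
      using holo2_on_divide_fst[OF e(1) A F] by (auto simp: F_def)
    have "Dy f (x, y) = g (0, x)" if x: "x \<in> A" for x
    proof -
      have "isCont g (0, x)" using g(1) x e(1) by (auto simp: holo2_on_def intro: cdiff2_imp_isCont)
      then have "isCont (\<lambda>h. g (h, x)) 0" 
        by (rule isCont_o2[rotated]) (intro continuous_intros)
      then have "(\<lambda>h. g (h, x)) \<midarrow>0\<rightarrow> g (0, x)" by (simp add: isCont_def)
      moreover have "\<forall>\<^sub>F h in at 0. g (h, x) = (f (x, y + h) - f (x, y)) / h"
        using eventually_at_ball[OF e(1), of 0 UNIV] eventually_neq_at_within[of 0 0 UNIV]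
      proof eventually_elim
        case (elim h)
        then show ?case using g(2)[of h x] x by (simp add: F_def field_simps)
      qed
      ultimately have "(\<lambda>h. (f (x, y + h) - f (x, y)) / h) \<midarrow>0\<rightarrow> g (0, x)"
        using tendsto_cong by fast
      then have "((\<lambda>y. f (x, y)) has_field_derivative g (0, x)) (at y)"
        by (simp add: DERIV_def)
      then show ?thesis by (simp add: Dy_def DERIV_imp_deriv)
    qed
    moreover have "(\<lambda>x. g (0, x)) holomorphic_on A"
      using holo2_on_slices(2)[OF g(1) open_ball A] e(1) by simp
    ultimately show ?thesis by (simp cong: holomorphic_cong)
  qed
qed

section \<open>Germs at the origin\<close>

text \<open>
  All arguments are local at the origin, and blow-ups fix the origin of the new chart. Stating everything
  for functions holomorphic on some neighbourhood of \<open>(0, 0)\<close>, up to equality near \<open>(0, 0)\<close>, avoids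
  keeping track of radii.
\<close>

abbreviation (input) near0 :: "(complex \<times> complex \<Rightarrow> bool) \<Rightarrow> bool" where
  "near0 P \<equiv> eventually P (nhds (0, 0))"

definition holo2_germ :: "(complex \<times> complex \<Rightarrow> complex) \<Rightarrow> bool" where
  "holo2_germ f \<longleftrightarrow> (\<forall>\<^sub>F z in nhds (0, 0). cdiff2 f z)"

lemma near0_polydisc: "eventually P (nhds (0 :: complex, 0 :: complex)) \<longleftrightarrow> (\<exists>r>0. \<forall>x\<in>ball 0 r. \<forall>y\<in>ball 0 r. P (x, y))"
proof
  assume "eventually P (nhds (0, 0))"
  then have "eventually P (nhds 0 \<times>\<^sub>F nhds 0)" by (simp add: nhds_prod)
  then obtain Q R where QR: "eventually Q (nhds (0::complex))" "eventually R (nhds (0::complex))"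
    "\<And>x y. Q x \<Longrightarrow> R y \<Longrightarrow> P (x, y)" by (auto simp: eventually_prod_filter)
  obtain s t where "s > 0" "t > 0" "\<And>x. x \<in> ball 0 s \<Longrightarrow> Q x" "\<And>x. x \<in> ball 0 t \<Longrightarrow> R x"
    using QR(1,2) by (auto simp: eventually_nhds_metric dist_commute)
  then show "\<exists>r>0. \<forall>x\<in>ball 0 r. \<forall>y\<in>ball 0 r. P (x, y)"
    using QR(3) by (intro exI[of _ "min s t"]) auto
next
  assume "\<exists>r>0. \<forall>x\<in>ball 0 r. \<forall>y\<in>ball 0 r. P (x, y)"
  then obtain r where r: "r > 0" "\<forall>x\<in>ball 0 r. \<forall>y\<in>ball 0 r. P (x, y)" by blast
  have "\<forall>\<^sub>F z in nhds (0::complex, 0::complex). z \<in> ball 0 r \<times> ball 0 r"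
    using r(1) by (intro eventually_nhds_in_open open_Times) auto
  then show "eventually P (nhds (0, 0))"
    by eventually_elim (use r(2) in auto)
qed

lemma holo2_germ_iff: "holo2_germ f \<longleftrightarrow> (\<exists>r>0. holo2_on f (ball 0 r \<times> ball 0 r))"
  unfolding holo2_germ_def near0_polydisc holo2_on_def by auto

lemma holo2_germ_const [simp]: "holo2_germ (\<lambda>z. c)"
  and holo2_germ_fst [simp]: "holo2_germ fst"
  and holo2_germ_snd [simp]: "holo2_germ snd"
  by (simp_all add: holo2_germ_def)

lemma holo2_germ_add: "holo2_germ f \<Longrightarrow> holo2_germ g \<Longrightarrow> holo2_germ (\<lambda>z. f z + g z)"
  unfolding holo2_germ_def by (erule (1) eventually_elim2) (rule cdiff2_add)

lemma holo2_germ_diff: "holo2_germ f \<Longrightarrow> holo2_germ g \<Longrightarrow> holo2_germ (\<lambda>z. f z - g z)"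
  unfolding holo2_germ_def by (erule (1) eventually_elim2) (rule cdiff2_diff)

lemma holo2_germ_mult: "holo2_germ f \<Longrightarrow> holo2_germ g \<Longrightarrow> holo2_germ (\<lambda>z. f z * g z)"
  unfolding holo2_germ_def by (erule (1) eventually_elim2) (rule cdiff2_mult)

lemma holo2_germ_power: "holo2_germ f \<Longrightarrow> holo2_germ (\<lambda>z. f z ^ n)"
  unfolding holo2_germ_def by (erule eventually_mono) (rule cdiff2_power)

lemma holo2_germ_isCont: "holo2_germ f \<Longrightarrow> isCont f (0, 0)"
  unfolding holo2_germ_def by (rule cdiff2_imp_isCont) (rule eventually_nhds_x_imp_x)

lemma holo2_germ_nonzero:
  assumes "holo2_germ g" "g (0, 0) \<noteq> 0"
  shows "near0 (\<lambda>z. g z \<noteq> 0)"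
proof -
  have "(g \<longlongrightarrow> g (0, 0)) (nhds (0, 0))"
    using holo2_germ_isCont[OF assms(1)] isCont_iff_tendsto_nhds by blast
  then show ?thesis using assms(2) by (rule tendsto_imp_eventually_ne)
qed

lemma holo2_germ_divide:
  assumes "holo2_germ f" "holo2_germ g" "g (0, 0) \<noteq> 0"
  shows "holo2_germ (\<lambda>z. f z / g z)"
  using assms(1,2) holo2_germ_nonzero[OF assms(2,3)] unfolding holo2_germ_def
  by eventually_elim (rule cdiff2_divide)

lemma tendsto_germ_Pair:
  assumes "holo2_germ u" "holo2_germ v" "u (0, 0) = 0" "v (0, 0) = 0"
  shows "((\<lambda>z. (u z, v z)) \<longlongrightarrow> (0, 0)) (nhds (0, 0))"
proof -
  have "(u \<longlongrightarrow> u (0, 0)) (nhds (0, 0))" "(v \<longlongrightarrow> v (0, 0)) (nhds (0, 0))"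
    using assms(1,2)[THEN holo2_germ_isCont] isCont_iff_tendsto_nhds by blast+
  then show ?thesis using assms(3,4) tendsto_Pair by fastforce
qed

lemma near0_compose:
  assumes "near0 P" "holo2_germ u" "holo2_germ v" "u (0, 0) = 0" "v (0, 0) = 0"
  shows "near0 (\<lambda>z. P (u z, v z))"
  using eventually_compose_filterlim[OF assms(1) tendsto_germ_Pair[OF assms(2-5)]] .

lemma holo2_germ_compose:
  assumes "holo2_germ f" "holo2_germ u" "holo2_germ v" "u (0, 0) = 0" "v (0, 0) = 0"
  shows "holo2_germ (\<lambda>z. f (u z, v z))"
  using near0_compose[OF assms(1)[unfolded holo2_germ_def] assms(2-5)] assms(2,3)
  unfolding holo2_germ_def by eventually_elim (rule cdiff2_compose)

lemma near0_slice: "near0 P \<Longrightarrow> \<forall>\<^sub>F y in nhds 0. P (0, y)"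
  unfolding near0_polydisc by (auto simp: eventually_nhds_metric dist_commute)

lemma holo2_germ_divide_fst:
  assumes "holo2_germ f" "\<forall>\<^sub>F y in nhds 0. f (0, y) = 0"
  obtains g where "holo2_germ g" "near0 (\<lambda>z. f z = fst z * g z)"
proof -
  obtain r where r: "r > 0" "holo2_on f (ball 0 r \<times> ball 0 r)" using assms(1) holo2_germ_iff by blast
  obtain s where s: "s > 0" "\<And>y. y \<in> ball 0 s \<Longrightarrow> f (0, y) = 0"
    using assms(2) by (auto simp: eventually_nhds_metric dist_commute)
  let ?t = "min r s"
  have "holo2_on f (ball 0 ?t \<times> ball 0 ?t)" by (rule holo2_on_subset[OF r(2)]) auto
  then obtain g where "holo2_on g (ball 0 ?t \<times> ball 0 ?t)"
    "\<And>x y. x \<in> ball 0 ?t \<Longrightarrow> y \<in> ball 0 ?t \<Longrightarrow> f (x, y) = x * g (x, y)"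
    by (rule holo2_on_divide_fst[rotated 2]) (use r s in auto)
  then show thesis using r s that[of g]
    unfolding holo2_germ_iff near0_polydisc by (metis fst_conv min_less_iff_conj)
qed

text \<open>
  Identities may be checked off the line \<open>x = 0\<close>. This is what justifies cancelling powers of \<open>x\<close>.
\<close>

lemma near0_eqI:
  assumes "holo2_germ f" "holo2_germ g" "near0 (\<lambda>z. fst z \<noteq> 0 \<longrightarrow> f z = g z)"
  shows "near0 (\<lambda>z. f z = g z)"
proof -
  have "near0 (\<lambda>z. (cdiff2 f z \<and> cdiff2 g z) \<and> (fst z \<noteq> 0 \<longrightarrow> f z = g z))"
    using assms unfolding holo2_germ_def by (intro eventually_conj) auto
  then obtain r where r: "r > 0" 
    "\<And>x y. x \<in> ball 0 r \<Longrightarrow> y \<in> ball 0 r \<Longrightarrow> cdiff2 f (x, y) \<and> cdiff2 g (x, y) \<and> (x \<noteq> 0 \<longrightarrow> f (x, y) = g (x, y))"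
    unfolding near0_polydisc by auto
  have "f (x, y) = g (x, y)" if "x \<in> ball 0 r" "y \<in> ball 0 r" for x y
  proof (cases "x = 0")
    case True
    have "isCont (\<lambda>x. f (x, y)) 0" "isCont (\<lambda>x. g (x, y)) 0"
      using r(2)[of 0 y] r(1) that(2)
      by (simp_all add: cdiff2_imp_partial(1) field_differentiable_imp_continuous_at)
    then have "(\<lambda>x. f (x, y)) \<midarrow>0\<rightarrow> f (0, y)" "(\<lambda>x. g (x, y)) \<midarrow>0\<rightarrow> g (0, y)" 
      by (auto simp: isCont_def)
    moreover have "\<forall>\<^sub>F x in at 0. f (x, y) = g (x, y)"
      using eventually_at_ball[OF r(1), of 0 UNIV] eventually_neq_at_within[of 0 0 UNIV]
      by eventually_elim (use r(2) that(2) in auto)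
    ultimately have "(\<lambda>x. f (x, y)) \<midarrow>0\<rightarrow> f (0, y)" "(\<lambda>x. f (x, y)) \<midarrow>0\<rightarrow> g (0, y)"
      by (simp_all add: tendsto_cong[of "\<lambda>x. f (x, y)" "\<lambda>x. g (x, y)"])
    then show ?thesis using True tendsto_unique[OF at_neq_bot] by blast
  qed (use r that in auto)
  then show ?thesis unfolding near0_polydisc using r(1) by blast
qed

lemma near0_cancel_fst:
  assumes "holo2_germ f" "holo2_germ g" "near0 (\<lambda>z. fst z ^ n * f z = fst z ^ n * g z)"
  shows "near0 (\<lambda>z. f z = g z)"
  by (rule near0_eqI[OF assms(1,2)]) (use assms(3) in \<open>auto elim!: eventually_mono\<close>)

lemma holo2_germ_Dy: "holo2_germ f \<Longrightarrow> holo2_germ (Dy f)"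
  unfolding holo2_germ_iff using holo2_on_Dy[OF open_ball open_ball] by blast

section \<open>Leading monomials and the resonance relation\<close>

lemma analytic_at_ball:
  assumes "f analytic_on {a}"
  obtains r where "r > 0" "f holomorphic_on ball a r"
  using assms by (auto simp: analytic_on_def)

lemma analytic_at_tendsto: "f analytic_on {a} \<Longrightarrow> (f \<longlongrightarrow> f a) (nhds a)" for f :: "complex \<Rightarrow> complex"
  using analytic_at_imp_isCont isCont_iff_tendsto_nhds by blast

lemma holomorphic_zero_on_ball:
  assumes "f holomorphic_on ball 0 r" "\<forall>\<^sub>F y in nhds 0. f y = 0" "y \<in> ball 0 r"
  shows "f y = 0"
proof -
  obtain s where s: "s > 0" "\<And>y. y \<in> ball 0 s \<Longrightarrow> f y = 0"
    using assms(2) by (auto simp: eventually_nhds_metric dist_commute)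
  have "r > 0" using assms(3) by (metis ball_empty empty_iff not_le)
  then have ne: "ball (0::complex) (min r s) \<noteq> {}" using s(1) by simp
  show ?thesis
    by (rule analytic_continuation_open[OF open_ball open_ball ne connected_ball _ assms(1) holomorphic_on_const _ assms(3)])
      (use s in auto)
qed

definition has_order0 :: "(complex \<Rightarrow> complex) \<Rightarrow> nat \<Rightarrow> bool" where
  "has_order0 f i \<longleftrightarrow>
     (\<exists>u. u analytic_on {0} \<and> u 0 \<noteq> 0 \<and> (\<forall>\<^sub>F y in nhds 0. f y = y ^ i * u y))"

lemma has_order0_exists:
  assumes "f analytic_on {0}" "\<not> (\<forall>\<^sub>F y in nhds 0. f y = 0)"
  shows "\<exists>i. has_order0 f i"
proof (cases "f 0 = 0")
  case False
  then have "has_order0 f 0" unfolding has_order0_def using assms(1) by (intro exI[of _ f]) simp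
  then show ?thesis by blast
next
  case True
  obtain r where r: "r > 0" "f holomorphic_on ball 0 r" using assms(1) by (rule analytic_at_ball)
  have "\<not> f constant_on ball 0 r"
  proof
    assume "f constant_on ball 0 r"
    then obtain c where c: "\<And>x. x \<in> ball 0 r \<Longrightarrow> f x = c" by (auto simp: constant_on_def)
    then have "c = 0" using True r(1) by (metis centre_in_ball)
    moreover have "\<forall>\<^sub>F y in nhds 0. y \<in> ball (0::complex) r"
      using r(1) by (intro eventually_nhds_in_open) auto
    ultimately show False using assms(2) c eventually_mono by smt
  qed
  then obtain g s n where g: "0 < s" "g holomorphic_on ball 0 s"
     "\<And>w. w \<in> ball 0 s \<Longrightarrow> f w = (w - 0) ^ n * g w" "\<And>w. w \<in> ball 0 s \<Longrightarrow> g w \<noteq> 0"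
    using holomorphic_factor_zero_nonconstant[OF r(2) open_ball connected_ball _ True] r(1)
    by (metis centre_in_ball)
  have "\<forall>\<^sub>F y in nhds 0. y \<in> ball (0::complex) s"
    using g(1) by (intro eventually_nhds_in_open) auto
  then have "\<forall>\<^sub>F y in nhds 0. f y = y ^ n * g y"
    by eventually_elim (use g(3) in simp)
  moreover have "g analytic_on {0}" using g(1,2) by (auto simp: analytic_on_def)
  ultimately have "has_order0 f n" unfolding has_order0_def using g(1,4) by auto
  then show ?thesis by blast
qed

lemma holo2_germ_slice:
  assumes "holo2_germ f"
  shows "(\<lambda>y. f (0, y)) analytic_on {0}"
proof -
  obtain r where r: "r > 0" "holo2_on f (ball 0 r \<times> ball 0 r)" using assms unfolding holo2_germ_iff by blast
  then have "(\<lambda>y. f (0, y)) holomorphic_on ball 0 r"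
    by (intro holo2_on_slices(2)[OF r(2) open_ball open_ball]) simp
  then show ?thesis using r(1) by (auto simp: analytic_on_def)
qed

text \<open>
  \<open>x\<^sup>k y\<^sup>i\<close> is the leading monomial of \<open>f\<close> when the power of \<open>x\<close> is compared first: \<open>f = x\<^sup>k A\<close>, and \<open>A\<close>
  restricted to the line \<open>x = 0\<close> vanishes to order \<open>i\<close>.
\<close>

definition has_lex_order :: "(complex \<times> complex \<Rightarrow> complex) \<Rightarrow> nat \<Rightarrow> nat \<Rightarrow> bool" where
  "has_lex_order f k i \<longleftrightarrow>
     (\<exists>A. holo2_germ A \<and> near0 (\<lambda>z. f z = fst z ^ k * A z) \<and> has_order0 (\<lambda>y. A (0, y)) i)"

text \<open>
  Divide by \<open>x\<close> as long as the function vanishes on \<open>x = 0\<close>. This stops: on a line \<open>y = y0\<close> on which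
  \<open>f\<close> does not vanish identically, the order of vanishing at \<open>x = 0\<close> bounds the number of divisions.
  The divisions take place on a fixed polydisc \<open>D \<times> D\<close>, since such a line need not meet a smaller one.
\<close>

lemma has_lex_order_exists:
  assumes f: "holo2_germ f" and nz: "\<not> near0 (\<lambda>z. f z = 0)"
  shows "\<exists>k i. has_lex_order f k i"
proof -
  obtain r where r: "r > 0" and hf: "holo2_on f (ball 0 r \<times> ball 0 r)" using f unfolding holo2_germ_iff by blast
  define D where "D = ball (0::complex) r"
  note D = hf[folded D_def]
  have "0 \<in> D" "open D" using r by (auto simp: D_def)
  have "\<not> (\<forall>x\<in>D. \<forall>y\<in>D. f (x, y) = 0)" using nz r unfolding near0_polydisc D_def by blast
  then obtain x0 y0 where xy: "x0 \<in> D" "y0 \<in> D" "f (x0, y0) \<noteq> 0" by blast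
  have holf: "(\<lambda>x. f (x, y0)) holomorphic_on D"
    using holo2_on_slices(1)[OF D \<open>open D\<close> \<open>open D\<close>] xy by blast
  then have "(\<lambda>x. f (x, y0)) analytic_on {0}" using r by (auto simp: analytic_on_def D_def)
  moreover have "\<not> (\<forall>\<^sub>F x in nhds 0. f (x, y0) = 0)"
    using holomorphic_zero_on_ball[OF holf[unfolded D_def] _ xy(1)[unfolded D_def]] xy(3) by blast
  ultimately obtain m u where u: "u analytic_on {0}" "u 0 \<noteq> 0" "\<forall>\<^sub>F x in nhds 0. f (x, y0) = x ^ m * u x"
    using has_order0_exists unfolding has_order0_def by blast
  have inD: "\<forall>\<^sub>F x in nhds 0. x \<in> D" using \<open>0 \<in> D\<close> \<open>open D\<close> by (rule eventually_nhds_in_open[rotated])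
  have "\<exists>k A. holo2_on A (D \<times> D) \<and> (\<forall>x\<in>D. \<forall>y\<in>D. f (x, y) = x ^ k * A (x, y)) \<and> (\<exists>y\<in>D. A (0, y) \<noteq> 0)"
  proof (rule ccontr)
    assume contr: "\<not> ?thesis"
    have "\<exists>A. holo2_on A (D \<times> D) \<and> (\<forall>x\<in>D. \<forall>y\<in>D. f (x, y) = x ^ k * A (x, y))" for k
    proof (induction k)
      case 0
      then show ?case using D by (intro exI[of _ f]) auto
    next
      case (Suc k)
      then obtain A where A: "holo2_on A (D \<times> D)" "\<forall>x\<in>D. \<forall>y\<in>D. f (x, y) = x ^ k * A (x, y)" by blast
      then have zero: "\<And>y. y \<in> D \<Longrightarrow> A (0, y) = 0" using contr by blast
      obtain B where B: "holo2_on B (D \<times> D)" "\<And>x y. x \<in> D \<Longrightarrow> y \<in> D \<Longrightarrow> A (x, y) = x * B (x, y)"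
        using holo2_on_divide_fst[OF r open_ball A(1)[unfolded D_def], folded D_def, OF zero] by blast
      then show ?case using A by (intro exI[of _ B]) auto
    qed
    then obtain A where A: "holo2_on A (D \<times> D)" "\<forall>x\<in>D. \<forall>y\<in>D. f (x, y) = x ^ Suc m * A (x, y)" by blast
    have "(\<lambda>x. A (x, y0)) holomorphic_on D"
      using holo2_on_slices(1)[OF A(1) \<open>open D\<close> \<open>open D\<close>] xy by blast
    then have "(\<lambda>x. A (x, y0)) analytic_on {0}" using r by (auto simp: analytic_on_def D_def)
    then have lim1: "((\<lambda>x. x * A (x, y0)) \<longlongrightarrow> 0 * A (0, y0)) (at 0)"
      by (intro tendsto_intros) (use analytic_at_imp_isCont isCont_def in blast)
    have lim2: "(u \<longlongrightarrow> u 0) (at 0)"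
      using u(1) analytic_at_imp_isCont isCont_def by blast
    have "\<forall>\<^sub>F x in nhds 0. x \<noteq> 0 \<longrightarrow> u x = x * A (x, y0)"
      using u(3) inD by eventually_elim (use A(2) xy(2) in auto)
    then have "\<forall>\<^sub>F x in at 0. u x = x * A (x, y0)" by (simp add: eventually_at_filter)
    then have "(u \<longlongrightarrow> 0 * A (0, y0)) (at 0)" using lim1 tendsto_cong by fast
    then show False using lim2 u(2) tendsto_unique[OF at_neq_bot] by fastforce
  qed
  then obtain k A where A: "holo2_on A (D \<times> D)" "\<forall>x\<in>D. \<forall>y\<in>D. f (x, y) = x ^ k * A (x, y)"
    "\<exists>y\<in>D. A (0, y) \<noteq> 0" by blast
  have germ: "holo2_germ A" unfolding holo2_germ_iff using A(1) r by (auto simp: D_def)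
  have "(\<lambda>y. A (0, y)) holomorphic_on D"
    using holo2_on_slices(2)[OF A(1) \<open>open D\<close> \<open>open D\<close>] \<open>0 \<in> D\<close> by blast
  then have "\<not> (\<forall>\<^sub>F y in nhds 0. A (0, y) = 0)"
    using holomorphic_zero_on_ball A(3) unfolding D_def by blast
  then obtain i where "has_order0 (\<lambda>y. A (0, y)) i" 
    using has_order0_exists[OF holo2_germ_slice[OF germ]] by blast
  moreover have "near0 (\<lambda>z. f z = fst z ^ k * A z)"
    unfolding near0_polydisc using A(2) r by (auto simp: D_def)
  ultimately show ?thesis unfolding has_lex_order_def using germ by blast
qed

text \<open>
  A map \<open>(x, y) \<mapsto> (x g, h)\<close> with \<open>g = \<lambda>\<close> and \<open>h = \<nu> y\<close> on the line \<open>x = 0\<close> multiplies the coefficient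
  of the leading monomial \<open>x\<^sup>k y\<^sup>i\<close> by \<open>\<lambda>\<^sup>k \<nu>\<^sup>i\<close>. Cross-multiplied invariance of \<open>P / Q\<close> therefore equates the two multipliers. For
  \<open>\<nu> = 0\<close> the statement keeps its content through \<open>0\<^sup>0 = 1\<close>: if \<open>j = 0\<close>, it forces \<open>i = 0\<close> as soon as \<open>\<lambda> \<noteq> 0\<close>.
\<close>

lemma lex_order_of_invariant_quotient:
  assumes g: "holo2_germ g" "\<forall>\<^sub>F y in nhds 0. g (0, y) = lam"
    and h: "holo2_germ h" "\<forall>\<^sub>F y in nhds 0. h (0, y) = nu * y"
    and P: "has_lex_order P k i" and Q: "has_lex_order Q l j"
    and inv: "near0 (\<lambda>z. P (fst z * g z, h z) * Q z = P z * Q (fst z * g z, h z))"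
  shows "lam ^ k * nu ^ i = lam ^ l * nu ^ j"
proof -
  obtain A u where A: "holo2_germ A" "near0 (\<lambda>z. P z = fst z ^ k * A z)"
    "u analytic_on {0}" "u 0 \<noteq> 0" "\<forall>\<^sub>F y in nhds 0. A (0, y) = y ^ i * u y"
    using P unfolding has_lex_order_def has_order0_def by blast
  obtain B v where B: "holo2_germ B" "near0 (\<lambda>z. Q z = fst z ^ l * B z)"
    "v analytic_on {0}" "v 0 \<noteq> 0" "\<forall>\<^sub>F y in nhds 0. B (0, y) = y ^ j * v y"
    using Q unfolding has_lex_order_def has_order0_def by blast
  have xg: "holo2_germ (\<lambda>z. fst z * g z)" by (intro holo2_germ_mult g) simp
  have h0: "h (0, 0) = 0" using eventually_nhds_x_imp_x[OF h(2)] by simp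
  note lift = near0_compose[OF _ xg h(1), simplified, OF _ h0]
  note glift = holo2_germ_compose[OF _ xg h(1), simplified, OF _ h0]
  have "near0 (\<lambda>z. fst z ^ (k + l) * (g z ^ k * A (fst z * g z, h z) * B z) =
     fst z ^ (k + l) * (g z ^ l * A z * B (fst z * g z, h z)))"
    using inv A(2) B(2) lift[OF A(2)] lift[OF B(2)]
    by eventually_elim (simp add: power_add power_mult_distrib mult_ac)
  then have "near0 (\<lambda>z. g z ^ k * A (fst z * g z, h z) * B z = g z ^ l * A z * B (fst z * g z, h z))"
    by (rule near0_cancel_fst[rotated 2])
      (intro holo2_germ_mult holo2_germ_power A(1) B(1) g(1) glift[OF A(1)] glift[OF B(1)])+
  from near0_slice[OF this] g(2) h(2) have eq: "\<forall>\<^sub>F y in nhds 0. lam ^ k * A (0, nu * y) * B (0, y) = lam ^ l * A (0, y) * B (0, nu * y)"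
    by eventually_elim simp
  have nu: "((\<lambda>y. nu * y) \<longlongrightarrow> 0) (nhds 0)"
  proof -
    have "isCont (\<lambda>y. nu * y) 0" by (intro continuous_intros)
    then show ?thesis using isCont_iff_tendsto_nhds[of 0 "\<lambda>y. nu * y"] by simp
  qed
  note Anu = eventually_compose_filterlim[OF A(5) nu]
  note Bnu = eventually_compose_filterlim[OF B(5) nu]
  have "\<forall>\<^sub>F y in nhds 0. y \<noteq> 0 \<longrightarrow> lam ^ k * nu ^ i * u (nu * y) * v y = lam ^ l * nu ^ j * u y * v (nu * y)"
    using eq A(5) B(5) Anu Bnu
  proof eventually_elim
    case (elim y)
    then have "y ^ (i + j) * (lam ^ k * nu ^ i * u (nu * y) * v y) =
       y ^ (i + j) * (lam ^ l * nu ^ j * u y * v (nu * y))"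
      by (simp add: power_add power_mult_distrib mult_ac)
    then show ?case by auto
  qed
  then have ev: "\<forall>\<^sub>F y in at 0. lam ^ k * nu ^ i * u (nu * y) * v y = lam ^ l * nu ^ j * u y * v (nu * y)"
    by (simp add: eventually_at_filter)
  have lims: "(w \<longlongrightarrow> w 0) (at 0)" "((\<lambda>y. w (nu * y)) \<longlongrightarrow> w 0) (at 0)" if "w analytic_on {0}" for w
    using analytic_at_tendsto[OF that] filterlim_compose[OF analytic_at_tendsto[OF that] nu]
    by (auto intro: tendsto_mono[OF at_within_le_nhds])
  have "((\<lambda>y. lam ^ k * nu ^ i * u (nu * y) * v y) \<longlongrightarrow> lam ^ k * nu ^ i * u 0 * v 0) (at 0)"
    "((\<lambda>y. lam ^ l * nu ^ j * u y * v (nu * y)) \<longlongrightarrow> lam ^ l * nu ^ j * u 0 * v 0) (at 0)"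
    by (intro tendsto_intros lims A B)+
  then have "lam ^ k * nu ^ i * u 0 * v 0 = lam ^ l * nu ^ j * u 0 * v 0"
    using ev tendsto_cong tendsto_unique[OF at_neq_bot] by fast
  then show ?thesis using A(4) B(4) by simp
qed

text \<open>
  Subtracting the right multiple of \<open>Q\<close> kills the common leading monomial.
\<close>

lemma lex_order_drop:
  assumes P: "has_lex_order P k i" and Q: "has_lex_order Q k i"
  shows "\<exists>c. \<not> has_lex_order (\<lambda>z. P z - c * Q z) k i"
proof -
  obtain A u where A: "holo2_germ A" "near0 (\<lambda>z. P z = fst z ^ k * A z)"
    "u analytic_on {0}" "u 0 \<noteq> 0" "\<forall>\<^sub>F y in nhds 0. A (0, y) = y ^ i * u y"
    using P unfolding has_lex_order_def has_order0_def by blast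
  obtain B v where B: "holo2_germ B" "near0 (\<lambda>z. Q z = fst z ^ k * B z)"
    "v analytic_on {0}" "v 0 \<noteq> 0" "\<forall>\<^sub>F y in nhds 0. B (0, y) = y ^ i * v y"
    using Q unfolding has_lex_order_def has_order0_def by blast
  define c where "c = u 0 / v 0"
  have "\<not> has_lex_order (\<lambda>z. P z - c * Q z) k i"
  proof
    assume "has_lex_order (\<lambda>z. P z - c * Q z) k i"
    then obtain C w where C: "holo2_germ C" "near0 (\<lambda>z. P z - c * Q z = fst z ^ k * C z)"
      "w analytic_on {0}" "w 0 \<noteq> 0" "\<forall>\<^sub>F y in nhds 0. C (0, y) = y ^ i * w y"
      unfolding has_lex_order_def has_order0_def by blast
    have "near0 (\<lambda>z. fst z ^ k * C z = fst z ^ k * (A z - c * B z))"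
      using A(2) B(2) C(2) by eventually_elim (simp add: algebra_simps)
    then have "near0 (\<lambda>z. C z = A z - c * B z)"
      by (rule near0_cancel_fst[rotated 2]) (intro holo2_germ_diff holo2_germ_mult A(1) B(1) C(1) holo2_germ_const)+
    then have "\<forall>\<^sub>F y in nhds 0. C (0, y) = A (0, y) - c * B (0, y)" using near0_slice by fast
    then have "\<forall>\<^sub>F y in nhds 0. y \<noteq> 0 \<longrightarrow> w y = u y - c * v y"
      using A(5) B(5) C(5)
    proof eventually_elim
      case (elim y)
      then have "y ^ i * w y = y ^ i * (u y - c * v y)" by (simp add: algebra_simps)
      then show ?case by auto
    qed
    then have ev: "\<forall>\<^sub>F y in at 0. w y = u y - c * v y" by (simp add: eventually_at_filter)
    have lims: "(t \<longlongrightarrow> t 0) (at 0)" if "t analytic_on {0}" for t :: "complex \<Rightarrow> complex"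
      using analytic_at_tendsto[OF that] by (auto intro: tendsto_mono[OF at_within_le_nhds])
    have "((\<lambda>y. u y - c * v y) \<longlongrightarrow> u 0 - c * v 0) (at 0)" "(w \<longlongrightarrow> w 0) (at 0)"
      by (intro tendsto_intros lims A B C)+
    then have "w 0 = u 0 - c * v 0"
      using ev tendsto_cong tendsto_unique[OF at_neq_bot] by fast
    then show False using C(4) B(4) by (simp add: c_def)
  qed
  then show ?thesis by blast
qed

text \<open>
  If \<open>P / Q\<close> is invariant, then so is \<open>(P - c Q) / Q\<close>, so \<open>P\<close> and \<open>Q\<close> may be assumed to have different
  leading monomials. The relation between the multipliers is then not a tautology. One subtraction is
  enough, since only the leading monomial of the numerator has to change.
\<close>

lemma resonance_of_invariant_quotient:
  assumes g: "holo2_germ g" "\<forall>\<^sub>F y in nhds 0. g (0, y) = lam"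
    and h: "holo2_germ h" "\<forall>\<^sub>F y in nhds 0. h (0, y) = nu * y"
    and P: "holo2_germ P" and Q: "holo2_germ Q" "has_lex_order Q l j"
    and inv: "near0 (\<lambda>z. P (fst z * g z, h z) * Q z = P z * Q (fst z * g z, h z))"
    and nonconst: "\<And>c. \<not> near0 (\<lambda>z. P z = c * Q z)"
  shows "\<exists>k i. (k, i) \<noteq> (l, j) \<and> lam ^ k * nu ^ i = lam ^ l * nu ^ j"
proof -
  have orders: "\<exists>k i. has_lex_order (\<lambda>z. P z - c * Q z) k i" for c
    using nonconst[of c] by (intro has_lex_order_exists holo2_germ_diff holo2_germ_mult P Q(1)) auto
  obtain c where "\<not> has_lex_order (\<lambda>z. P z - c * Q z) l j"
  proof (cases "has_lex_order P l j")
    case True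
    then show ?thesis using lex_order_drop[OF True Q(2)] that by blast
  next
    case False
    then show ?thesis using that[of 0] by simp
  qed
  then obtain k i where ki: "(k, i) \<noteq> (l, j)" "has_lex_order (\<lambda>z. P z - c * Q z) k i"
    using orders by fast
  have "lam ^ k * nu ^ i = lam ^ l * nu ^ j"
    by (rule lex_order_of_invariant_quotient[OF g h ki(2) Q(2)])
      (use inv in \<open>auto elim!: eventually_mono simp: algebra_simps\<close>)
  then show ?thesis using ki(1) by blast
qed

section \<open>Implicit functions\<close>

text \<open>
  The differential of \<open>(x, y) \<mapsto> (x, h (x, y))\<close> as a bounded linear operator, \<open>(s, t) \<mapsto> (s, a s + b t)\<close>,
  written as a sum of compositions so that its continuous dependence on \<open>a\<close> and \<open>b\<close> is visible.
\<close>

definition shear_blinfun :: "complex \<Rightarrow> complex \<Rightarrow> (complex \<times> complex) \<Rightarrow>\<^sub>L (complex \<times> complex)" where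
  "shear_blinfun a b = (Blinfun (\<lambda>t. (t, 0)) o\<^sub>L fst_blinfun) +
     (Blinfun (\<lambda>t. (0, t)) o\<^sub>L ((blinfun_mult_right a o\<^sub>L fst_blinfun) + (blinfun_mult_right b o\<^sub>L snd_blinfun)))"

lemma shear_blinfun_apply [simp]:
  "blinfun_apply (shear_blinfun a b) w = (fst w, a * fst w + b * snd w)"
proof -
  have "bounded_linear (\<lambda>t::complex. (t, 0::complex))" "bounded_linear (\<lambda>t::complex. (0::complex, t))"
    by (intro bounded_linear_Pair bounded_linear_ident bounded_linear_zero)+
  then show ?thesis
    by (simp add: shear_blinfun_def blinfun.add_left bounded_linear_Blinfun_apply)
qed

lemma continuous_on_shear_blinfun:
  "continuous_on W a \<Longrightarrow> continuous_on W b \<Longrightarrow> continuous_on W (\<lambda>z. shear_blinfun (a z) (b z))"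
  unfolding shear_blinfun_def
  by (intro continuous_intros bounded_linear.continuous_on[OF bounded_linear_blinfun_mult_right])

text \<open>
  The real inverse function theorem applied to \<open>(x, y) \<mapsto> (x, h (x, y))\<close>; the implicit function is
  holomorphic because the inverse of a complex-linear differential is complex-linear.
\<close>

lemma holo2_implicit_function:
  assumes h: "holo2_germ h" and h0: "h (0, 0) = 0" and nz: "Dy h (0, 0) \<noteq> 0"
  obtains \<psi> where "\<psi> analytic_on {0}" "\<psi> 0 = 0" "near0 (\<lambda>z. h z = 0 \<longleftrightarrow> snd z = \<psi> (fst z))"
proof -
  obtain r where r: "r > 0" "holo2_on h (ball 0 r \<times> ball 0 r)" using h unfolding holo2_germ_iff by blast
  define W where "W = ball (0::complex) r \<times> ball (0::complex) r"
  have W: "open W" "(0, 0) \<in> W" "holo2_on h W" using r by (auto simp: W_def open_Times)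
  define a where "a z = Dy (\<lambda>z. h (snd z, fst z)) (snd z, fst z)" for z
  have der: "(h has_derivative (\<lambda>w. a z * fst w + Dy h z * snd w)) (at z)" if z: "z \<in> W" for z
  proof -
    obtain p q where pq: "(h has_derivative (\<lambda>w. p * fst w + q * snd w)) (at (fst z, snd z))"
      using W(3) z by (auto simp: holo2_on_def cdiff2_def)
    from has_derivative_partials[OF pq] have "a z = p" "Dy h z = q"
      by (simp_all add: a_def Dy_def DERIV_imp_deriv)
    then show ?thesis using pq by simp
  qed
  have "holo2_on (\<lambda>z. h (snd z, fst z)) (ball 0 r \<times> ball 0 r)"
    using r(2) by (auto simp: holo2_on_def intro: cdiff2_swap)
  then have "continuous_on (ball 0 r \<times> ball 0 r) (Dy (\<lambda>z. h (snd z, fst z)))"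
    by (intro holo2_on_imp_continuous_on holo2_on_Dy open_ball)
  then have conta: "continuous_on W a"
    unfolding a_def by (rule continuous_on_compose2) (auto simp: W_def intro!: continuous_intros)
  have contb: "continuous_on W (Dy h)"
    unfolding W_def by (intro holo2_on_imp_continuous_on holo2_on_Dy open_ball r(2))
  define \<Phi> where "\<Phi> z = (fst z, h z)" for z
  define L where "L z = shear_blinfun (a z) (Dy h z)" for z
  have derL: "(\<Phi> has_derivative blinfun_apply (L z)) (at z)" if "z \<in> W" for z
    unfolding \<Phi>_def[abs_def] L_def
    by (rule has_derivative_eq_rhs[OF has_derivative_Pair[OF has_derivative_fst[OF has_derivative_ident] der[OF that]]])
      (simp add: fun_eq_iff)
  have contL: "continuous_on W L"
    unfolding L_def[abs_def] by (rule continuous_on_shear_blinfun[OF conta contb])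
  have inv: "shear_blinfun (- a (0, 0) / Dy h (0, 0)) (1 / Dy h (0, 0)) o\<^sub>L L (0, 0) = id_blinfun"
    by (rule blinfun_eqI) (use nz in \<open>simp add: L_def field_simps\<close>)
  obtain U' V g g' where U': "open U'" "U' \<subseteq> W" "(0, 0) \<in> U'" "open V" "\<Phi> (0, 0) \<in> V"
    and hom: "homeomorphism U' V \<Phi> g"
    and g: "\<And>y. y \<in> V \<Longrightarrow> (g has_derivative (g' y)) (at y)"
    "\<And>y. y \<in> V \<Longrightarrow> g' y = Hilbert_Choice.inv (blinfun_apply (L (g y)))"
    "\<And>y. y \<in> V \<Longrightarrow> bij (blinfun_apply (L (g y)))"
    by (rule inverse_function_theorem[OF W(1) derL contL W(2) inv]) blast+
  define \<psi> where "\<psi> x = snd (g (x, 0))" for x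
  define X where "X = (\<lambda>x. (x, 0)) -` V"
  have "open X" unfolding X_def by (rule open_vimage[OF U'(4)]) (intro continuous_intros)
  have "0 \<in> X" using U'(5) h0 by (simp add: X_def \<Phi>_def)
  have gx: "g (x, 0) = (x, \<psi> x)" "h (x, \<psi> x) = 0" if "x \<in> X" for x
  proof -
    have "\<Phi> (g (x, 0)) = (x, 0)" using hom that by (auto simp: homeomorphism_def X_def)
    then show "g (x, 0) = (x, \<psi> x)" "h (x, \<psi> x) = 0" 
      by (auto simp: \<Phi>_def \<psi>_def prod_eq_iff) (metis prod.collapse)
  qed
  have "(\<psi> has_field_derivative (- a (g (x, 0)) / Dy h (g (x, 0)))) (at x)" if x: "x \<in> X" for x
  proof -
    have xV: "(x, 0) \<in> V" using x by (simp add: X_def)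
    let ?z = "g (x, 0)"
    have "inj (blinfun_apply (L ?z))" using g(3)[OF xV] by (rule bij_is_inj)
    then have b: "Dy h ?z \<noteq> 0"
      using injD[of "blinfun_apply (L ?z)" "(0, 1)" "(0, 0)"] by (auto simp: L_def)
    have g'x: "g' (x, 0) (t, 0) = (t, - a ?z / Dy h ?z * t)" for t
    proof -
      have "blinfun_apply (L ?z) (t, - a ?z / Dy h ?z * t) = (t, 0)" using b by (simp add: L_def)
      then show ?thesis using g(2)[OF xV] \<open>inj (blinfun_apply (L ?z))\<close> by (metis inv_f_f)
    qed
    have "((\<lambda>x. (x, 0::complex)) has_derivative (\<lambda>t. (t, 0))) (at x)"
      by (auto intro!: derivative_eq_intros)
    from has_derivative_snd[OF diff_chain_at[OF this g(1)[OF xV]]]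
    have "(\<psi> has_derivative (\<lambda>t. snd (g' (x, 0) (t, 0)))) (at x)"
      by (simp add: o_def \<psi>_def[abs_def])
    then show ?thesis unfolding has_field_derivative_def
      by (rule has_derivative_eq_rhs) (simp add: fun_eq_iff g'x)
  qed
  then have "\<psi> holomorphic_on X" using \<open>open X\<close> by (auto simp: holomorphic_on_open)
  then have "\<psi> analytic_on {0}" using \<open>open X\<close> \<open>0 \<in> X\<close> analytic_at by blast
  moreover have "\<psi> 0 = 0"
  proof -
    have "g (0, 0) = (0, 0)" using hom U'(3) h0 by (auto simp: homeomorphism_def \<Phi>_def)
    then show ?thesis by (simp add: \<psi>_def)
  qed
  moreover have "near0 (\<lambda>z. h z = 0 \<longleftrightarrow> snd z = \<psi> (fst z))"
  proof -
    have "near0 (\<lambda>z. z \<in> U' \<inter> fst -` X)"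
      using U' \<open>open X\<close> \<open>0 \<in> X\<close> by (intro eventually_nhds_in_open open_Int open_vimage_fst) auto
    then show ?thesis
    proof eventually_elim
      case (elim z)
      then have x: "fst z \<in> X" and z: "g (\<Phi> z) = z" using hom by (auto simp: homeomorphism_def)
      then show ?case using gx[OF x] by (metis \<Phi>_def prod.collapse snd_conv)
    qed
  qed
  ultimately show thesis using that by blast
qed

section \<open>Blow-ups\<close>

text \<open>
  Pull-back along the chart \<open>(x, y) \<mapsto> (x, x (c + y))\<close> of the blow-up of the origin, centred at the
  point of the exceptional divisor \<open>x = 0\<close> that represents the direction \<open>(1, c)\<close>.
\<close>

definition blow_up :: "complex \<Rightarrow> (complex \<times> complex \<Rightarrow> complex) \<Rightarrow> complex \<times> complex \<Rightarrow> complex" where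
  "blow_up c f z = f (fst z, fst z * (c + snd z))"

lemma holo2_germ_blow_up_snd: "holo2_germ (\<lambda>z. fst z * (c + snd z))"
  by (intro holo2_germ_mult holo2_germ_add) simp_all

lemma near0_blow_up: "near0 P \<Longrightarrow> near0 (\<lambda>z. P (fst z, fst z * (c + snd z)))"
  by (rule near0_compose[OF _ holo2_germ_fst holo2_germ_blow_up_snd]) simp_all

lemma holo2_germ_blow_up: "holo2_germ f \<Longrightarrow> holo2_germ (blow_up c f)"
  unfolding blow_up_def[abs_def]
  by (rule holo2_germ_compose[OF _ holo2_germ_fst holo2_germ_blow_up_snd]) simp_all

text \<open>
  The image of a neighbourhood of the origin under the chart contains a disc in each line
  \<open>x = const \<noteq> 0\<close>, so the identity theorem applies line by line.
\<close>

lemma blow_up_nonzero: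
  assumes f: "holo2_germ f" and zero: "near0 (\<lambda>z. blow_up c f z = 0)"
  shows "near0 (\<lambda>z. f z = 0)"
proof -
  obtain r where r: "r > 0" and hf: "holo2_on f (ball 0 r \<times> ball 0 r)" using f unfolding holo2_germ_iff by blast
  obtain s where s: "s > 0" "\<And>x y. x \<in> ball 0 s \<Longrightarrow> y \<in> ball 0 s \<Longrightarrow> f (x, x * (c + y)) = 0"
    using zero unfolding near0_polydisc blow_up_def by auto
  \<comment> \<open>For \<open>|x| < t\<close> the disc around \<open>c x\<close> of radius \<open>s |x|\<close>, on which \<open>f (x, \<cdot>)\<close> is known to vanish, stays inside \<open>|y| < r\<close>.\<close>
  define t where "t = min (min r s) (r / (norm c + s + 1))"
  have t: "t > 0" "t \<le> r" "t \<le> s" "t \<le> r / (norm c + s + 1)" 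
    using r s(1) norm_ge_zero[of c] by (auto simp: t_def intro!: divide_pos_pos add_nonneg_pos)
  have "f (x, y) = 0" if x: "x \<in> ball 0 t" "x \<noteq> 0" and y: "y \<in> ball 0 t" for x y
  proof -
    have holx: "(\<lambda>y. f (x, y)) holomorphic_on ball 0 r"
      by (rule holo2_on_slices(2)[OF hf open_ball open_ball]) (use x t in auto)
    have sub: "ball (x * c) (norm x * s) \<subseteq> ball 0 r"
    proof
      fix w assume w: "w \<in> ball (x * c) (norm x * s)"
      have "norm w \<le> norm (x * c) + norm (w - x * c)" using norm_triangle_sub by blast
      also have "\<dots> < norm x * norm c + norm x * s" 
        using w by (simp add: norm_mult dist_norm norm_minus_commute)
      also have "\<dots> \<le> norm x * (norm c + s + 1)" by (simp add: distrib_left)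
      also have "\<dots> \<le> t * (norm c + s + 1)" using x s(1) by (intro mult_right_mono) auto
      also have "\<dots> \<le> r" using t(4) s(1) by (simp add: pos_le_divide_eq add_nonneg_pos)
      finally show "w \<in> ball 0 r" by simp
    qed
    have "f (x, w) = 0" if w: "w \<in> ball (x * c) (norm x * s)" for w
    proof -
      have "norm ((w - x * c) / x) < s" 
        using w x(2) by (simp add: norm_divide dist_norm norm_minus_commute divide_less_eq mult.commute)
      then have "f (x, x * (c + (w - x * c) / x)) = 0" using s(2) x t(3) by auto
      then show ?thesis using x(2) by (simp add: field_simps)
    qed
    moreover have "0 < norm x * s" using x(2) s(1) by simp
    then have "ball (x * c) (norm x * s) \<noteq> {}" by (simp add: not_le)
    ultimately show ?thesis
      by (rule_tac analytic_continuation_open[OF open_ball open_ball _ connected_ball sub holx holomorphic_on_const])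
        (use y t in auto)
  qed
  then have "near0 (\<lambda>z. fst z \<noteq> 0 \<longrightarrow> f z = 0)" unfolding near0_polydisc using t(1) by auto
  then show ?thesis by (intro near0_eqI[OF f holo2_germ_const])
qed

lemma near0_Dy_cong:
  assumes "near0 (\<lambda>z. f z = g z)"
  shows "near0 (\<lambda>z. Dy f z = Dy g z)"
proof -
  obtain r where r: "r > 0" "\<And>x y. x \<in> ball 0 r \<Longrightarrow> y \<in> ball 0 r \<Longrightarrow> f (x, y) = g (x, y)"
    using assms unfolding near0_polydisc by blast
  have "Dy f (x, y) = Dy g (x, y)" if "x \<in> ball 0 r" "y \<in> ball 0 r" for x y
  proof -
    have "\<forall>\<^sub>F w in nhds y. w \<in> ball 0 r" using that by (intro eventually_nhds_in_open) auto
    then have "\<forall>\<^sub>F w in nhds y. f (x, w) = g (x, w)" by eventually_elim (use r that in auto)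
    then show ?thesis unfolding Dy_def by (simp add: deriv_cong_ev)
  qed
  then show ?thesis unfolding near0_polydisc using r(1) by blast
qed

lemma near0_Dy_fst_power_mult:
  assumes "holo2_germ f"
  shows "near0 (\<lambda>z. Dy (\<lambda>z. fst z ^ n * f z) z = fst z ^ n * Dy f z)"
  using assms unfolding holo2_germ_def
proof eventually_elim
  case (elim z)
  then have "(\<lambda>y. f (fst z, y)) field_differentiable (at (snd z))"
    by (intro cdiff2_imp_partial) simp
  then show ?case by (simp add: Dy_def)
qed

lemma near0_Dy_blow_up:
  assumes "holo2_germ f"
  shows "near0 (\<lambda>z. Dy (blow_up c f) z = fst z * blow_up c (Dy f) z)"
  using near0_blow_up[OF assms[unfolded holo2_germ_def], of c]
proof eventually_elim
  case (elim z)
  let ?w = "fst z * (c + snd z)"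
  have "(\<lambda>y. f (fst z, y)) field_differentiable (at ?w)"
    using elim by (rule cdiff2_imp_partial)
  then have "((\<lambda>y. f (fst z, y)) has_field_derivative Dy f (fst z, ?w)) (at ?w)"
    by (simp add: Dy_def DERIV_deriv_iff_field_differentiable)
  moreover have "((\<lambda>y. fst z * (c + y)) has_field_derivative fst z) (at (snd z))"
    by (auto intro!: derivative_eq_intros)
  ultimately have "((\<lambda>y. f (fst z, fst z * (c + y))) has_field_derivative Dy f (fst z, ?w) * fst z) (at (snd z))"
    by (rule DERIV_chain2)
  then show ?case by (simp add: Dy_def[of "blow_up c f"] blow_up_def DERIV_imp_deriv)
qed

lemma holo2_germ_Dy_funpow: "holo2_germ f \<Longrightarrow> holo2_germ ((Dy ^^ j) f)"
  by (induction j) (auto intro: holo2_germ_Dy)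

lemma Dy_funpow_eq: "(Dy ^^ j) f (x, y) = (deriv ^^ j) (\<lambda>y. f (x, y)) y"
  by (induction j arbitrary: y) (simp_all add: Dy_def)

text \<open>
  On a line \<open>x = const\<close> the chart is affine in \<open>y\<close> with slope \<open>x\<close>, so each derivative in \<open>y\<close> brings out
  one factor \<open>x\<close>. This relates the derivatives of a function to those of its strict transform \<open>B\<close>.
\<close>

lemma blow_up_Dy_funpow:
  assumes A: "holo2_germ A" and B: "holo2_germ B" and AB: "near0 (\<lambda>z. blow_up c A z = fst z ^ s * B z)"
  shows "near0 (\<lambda>z. fst z ^ j * blow_up c ((Dy ^^ j) A) z = fst z ^ s * (Dy ^^ j) B z)"
proof (induction j)
  case 0
  then show ?case using AB by simp
next
  case (Suc j)
  note hA = holo2_germ_Dy_funpow[OF A, of j] and hB = holo2_germ_Dy_funpow[OF B, of j]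
  show ?case
    using near0_Dy_cong[OF Suc] near0_Dy_fst_power_mult[OF holo2_germ_blow_up[OF hA], of j c]
      near0_Dy_fst_power_mult[OF hB, of s] near0_Dy_blow_up[OF hA, of c]
    by eventually_elim (simp add: mult_ac)
qed

section \<open>Common branches through infinitely near points\<close>

lemma has_order0_not_zero: "has_order0 f i \<Longrightarrow> \<not> (\<forall>\<^sub>F y in nhds 0. f y = 0)"
proof
  assume "has_order0 f i" and f0: "\<forall>\<^sub>F y in nhds 0. f y = 0"
  then obtain u where u: "u analytic_on {0}" "u 0 \<noteq> 0" "\<forall>\<^sub>F y in nhds 0. f y = y ^ i * u y"
    by (auto simp: has_order0_def)
  have "\<forall>\<^sub>F y in nhds 0. u y \<noteq> 0"
    using tendsto_imp_eventually_ne[OF analytic_at_tendsto[OF u(1)] u(2)] .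
  with f0 u(3) have "\<forall>\<^sub>F y in nhds (0::complex). y = 0 \<or> False" by eventually_elim auto
  then show False using eventually_nhds_x_imp_x by (simp add: eventually_nhds) (metis UNIV_not_singleton open_UNIV not_open_singleton subsetI subset_singletonD empty_iff insertI1 singletonD)
qed

lemma has_order0_pos_imp_zero: "has_order0 f i \<Longrightarrow> i > 0 \<Longrightarrow> f 0 = 0"
  by (auto simp: has_order0_def dest!: eventually_nhds_x_imp_x)

primrec blow_ups :: "(nat \<Rightarrow> complex) \<Rightarrow> (complex \<times> complex \<Rightarrow> complex) \<Rightarrow> nat \<Rightarrow> complex \<times> complex \<Rightarrow> complex" where
  "blow_ups c f 0 = f"
| "blow_ups c f (Suc n) = blow_up (c n) (blow_ups c f n)"

lemma holo2_germ_blow_ups: "holo2_germ f \<Longrightarrow> holo2_germ (blow_ups c f n)"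
  by (induction n) (auto intro: holo2_germ_blow_up)

lemma blow_ups_nonzero:
  "holo2_germ f \<Longrightarrow> \<not> near0 (\<lambda>z. f z = 0) \<Longrightarrow> \<not> near0 (\<lambda>z. blow_ups c f n z = 0)"
  by (induction n) (auto dest: blow_up_nonzero[OF holo2_germ_blow_ups])

text \<open>
  The strict transform of the curve \<open>f = 0\<close> passes through every point of the sequence of infinitely
  near points with centres \<open>c\<close>.
\<close>

definition infinitely_near :: "(nat \<Rightarrow> complex) \<Rightarrow> (complex \<times> complex \<Rightarrow> complex) \<Rightarrow> bool" where
  "infinitely_near c f \<longleftrightarrow> (\<forall>n k i. has_lex_order (blow_ups c f n) k i \<longrightarrow> i > 0)"

text \<open>
  As the strict transform \<open>A n\<close> vanishes at the centre, its pull-back vanishes on the new exceptional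
  divisor, so the multiplicity \<open>k n\<close> of the divisor grows at every step. The growth is what makes \<open>f\<close>
  vanish to infinite order along a curve through all these points.
\<close>

lemma strict_transforms:
  assumes f: "holo2_germ f" "\<not> near0 (\<lambda>z. f z = 0)" and inf: "infinitely_near c f"
  obtains A k where
    "\<And>n. holo2_germ (A n)" "\<And>n. near0 (\<lambda>z. blow_ups c f n z = fst z ^ k n * A n z)"
    "\<And>n. \<not> (\<forall>\<^sub>F y in nhds 0. A n (0, y) = 0)" "\<And>n. A n (0, 0) = 0" "\<And>n. k n < k (Suc n)"
    "\<And>n. near0 (\<lambda>z. blow_up (c n) (A n) z = fst z ^ (k (Suc n) - k n) * A (Suc n) z)"
proof -
  have "\<exists>A k. holo2_germ A \<and> near0 (\<lambda>z. blow_ups c f n z = fst z ^ k * A z) \<and>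
     \<not> (\<forall>\<^sub>F y in nhds 0. A (0, y) = 0) \<and> A (0, 0) = 0" for n
  proof -
    obtain k i where ki: "has_lex_order (blow_ups c f n) k i"
      using has_lex_order_exists[OF holo2_germ_blow_ups[OF f(1)] blow_ups_nonzero[OF f]] by blast
    then have "i > 0" using inf by (auto simp: infinitely_near_def)
    then show ?thesis using ki has_order0_not_zero has_order0_pos_imp_zero
      unfolding has_lex_order_def by blast
  qed
  then have "\<exists>A. \<forall>n. \<exists>k. holo2_germ (A n) \<and> near0 (\<lambda>z. blow_ups c f n z = fst z ^ k * A n z) \<and>
     \<not> (\<forall>\<^sub>F y in nhds 0. A n (0, y) = 0) \<and> A n (0, 0) = 0" by (intro choice allI)
  then obtain A where "\<forall>n. \<exists>k. holo2_germ (A n) \<and> near0 (\<lambda>z. blow_ups c f n z = fst z ^ k * A n z) \<and>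
     \<not> (\<forall>\<^sub>F y in nhds 0. A n (0, y) = 0) \<and> A n (0, 0) = 0" ..
  then have "\<exists>k. \<forall>n. holo2_germ (A n) \<and> near0 (\<lambda>z. blow_ups c f n z = fst z ^ k n * A n z) \<and>
     \<not> (\<forall>\<^sub>F y in nhds 0. A n (0, y) = 0) \<and> A n (0, 0) = 0" by (intro choice allI) blast
  then obtain k where A: "\<And>n. holo2_germ (A n)"
    and PA: "\<And>n. near0 (\<lambda>z. blow_ups c f n z = fst z ^ k n * A n z)"
    and nz: "\<And>n. \<not> (\<forall>\<^sub>F y in nhds 0. A n (0, y) = 0)" and A0: "\<And>n. A n (0, 0) = 0"
    by blast
  have eq: "near0 (\<lambda>z. fst z ^ k n * blow_up (c n) (A n) z = fst z ^ k (Suc n) * A (Suc n) z)" for n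
    using PA[of "Suc n"] near0_blow_up[OF PA[of n], of "c n"]
    by eventually_elim (simp add: blow_up_def)
  have less: "k n < k (Suc n)" for n
  proof (rule ccontr)
    assume "\<not> k n < k (Suc n)"
    then obtain d where d: "k n = k (Suc n) + d" using le_Suc_ex[of "k (Suc n)" "k n"] by auto
    have "near0 (\<lambda>z. fst z ^ k (Suc n) * (fst z ^ d * blow_up (c n) (A n) z) = fst z ^ k (Suc n) * A (Suc n) z)"
      using eq[of n] by (simp add: d power_add mult.assoc)
    then have "near0 (\<lambda>z. fst z ^ d * blow_up (c n) (A n) z = A (Suc n) z)"
      by (rule near0_cancel_fst[rotated 2])
        (intro holo2_germ_mult holo2_germ_power holo2_germ_fst holo2_germ_blow_up A)+
    from near0_slice[OF this] have "\<forall>\<^sub>F y in nhds 0. A (Suc n) (0, y) = 0"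
      by eventually_elim (simp add: blow_up_def A0)
    then show False using nz by blast
  qed
  have "near0 (\<lambda>z. blow_up (c n) (A n) z = fst z ^ (k (Suc n) - k n) * A (Suc n) z)" for n
  proof -
    obtain d where d: "k (Suc n) = k n + d" using le_Suc_ex[OF less_imp_le[OF less[of n]]] by blast
    have "near0 (\<lambda>z. fst z ^ k n * blow_up (c n) (A n) z = fst z ^ k n * (fst z ^ (k (Suc n) - k n) * A (Suc n) z))"
      using eq[of n] by (simp add: d power_add mult.assoc)
    then show ?thesis
      by (rule near0_cancel_fst[rotated 2])
        (intro holo2_germ_mult holo2_germ_power holo2_germ_fst holo2_germ_blow_up A)+
  qed
  then show thesis using that[of A k] A PA nz A0 less by blast
qed

lemma analytic_zero_of_derivs:
  assumes "f analytic_on {0}" "\<And>j. (deriv ^^ j) f 0 = 0"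
  shows "\<forall>\<^sub>F y in nhds 0. f y = 0"
proof -
  obtain r where r: "r > 0" "f holomorphic_on ball 0 r" using assms(1) by (rule analytic_at_ball)
  have "\<forall>\<^sub>F y in nhds 0. y \<in> ball (0::complex) r" using r by (intro eventually_nhds_in_open) auto
  then show ?thesis
    by eventually_elim (rule holomorphic_fun_eq_0_on_ball[OF r(2)], use assms(2) in auto)
qed

lemma funpow_deriv_eventually_zero:
  "\<forall>\<^sub>F y in nhds 0. f y = 0 \<Longrightarrow> (deriv ^^ j) f 0 = 0" for f :: "complex \<Rightarrow> complex"
proof -
  assume "\<forall>\<^sub>F y in nhds 0. f y = 0"
  then have "(deriv ^^ j) f 0 = (deriv ^^ j) (\<lambda>y. 0) 0" by (intro higher_deriv_cong_ev) auto
  then show ?thesis by simp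
qed

text \<open>
  The order \<open>e\<close> in \<open>y\<close> of the strict transform at the centre does not increase under blowing up, so it
  is constant from some \<open>m\<close> on; taking \<open>e\<close> minimal over all stages and \<open>m\<close> a stage where it is attained gives
  this at once. From there on the exponent of the divisor grows by exactly \<open>e\<close> at each step, and the
  derivatives of order \<open>e - 1\<close> in \<open>y\<close> of the strict transforms are the successive strict transforms of one
  smooth curve, transversal to the divisor. So a possibly multiple branch is captured by a smooth curve.
\<close>

lemma infinitely_near_smooth_germs:
  assumes f: "holo2_germ f" "\<not> near0 (\<lambda>z. f z = 0)" and inf: "infinitely_near c f"
  obtains m h where "\<And>n. n \<ge> m \<Longrightarrow> holo2_germ (h n) \<and> h n (0, 0) = 0 \<and> Dy (h n) (0, 0) \<noteq> 0 \<and>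
     near0 (\<lambda>z. blow_up (c n) (h n) z = fst z * h (Suc n) z)"
proof -
  obtain A k where A: "\<And>n. holo2_germ (A n)"
    "\<And>n. \<not> (\<forall>\<^sub>F y in nhds 0. A n (0, y) = 0)" "\<And>n. A n (0, 0) = 0" "\<And>n. k n < k (Suc n)"
    "\<And>n. near0 (\<lambda>z. blow_up (c n) (A n) z = fst z ^ (k (Suc n) - k n) * A (Suc n) z)"
    by (rule strict_transforms[OF f inf]) blast
  define s where "s n = k (Suc n) - k n" for n
  have nz: "\<exists>j. (Dy ^^ j) (A n) (0, 0) \<noteq> 0" for n
    using analytic_zero_of_derivs[OF holo2_germ_slice[OF A(1)[of n]]] A(2)[of n] by (auto simp: Dy_funpow_eq)
  define e where "e = (LEAST j. \<exists>n. (Dy ^^ j) (A n) (0, 0) \<noteq> 0)"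
  have "\<exists>j n. (Dy ^^ j) (A n) (0, 0) \<noteq> 0" using nz[of 0] by blast
  then have "\<exists>n. (Dy ^^ e) (A n) (0, 0) \<noteq> 0" unfolding e_def by (rule LeastI_ex)
  then obtain m where m: "(Dy ^^ e) (A m) (0, 0) \<noteq> 0" by blast
  have below: "(Dy ^^ j) (A n) (0, 0) = 0" if "j < e" for j n
    using not_less_Least[OF that[unfolded e_def]] by blast
  have "e > 0"
  proof (rule ccontr)
    assume "\<not> e > 0"
    then show False using m A(3) by simp
  qed
  have hA: "holo2_germ ((Dy ^^ j) (A n))" for j n using A(1) by (rule holo2_germ_Dy_funpow)
  have rel: "near0 (\<lambda>z. fst z ^ j * blow_up (c n) ((Dy ^^ j) (A n)) z = fst z ^ s n * (Dy ^^ j) (A (Suc n)) z)" for j n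
    using blow_up_Dy_funpow[OF A(1) A(1) A(5)] by (simp add: s_def)
  have step: "s n = e \<and> (Dy ^^ e) (A (Suc n)) (0, 0) \<noteq> 0" if n: "(Dy ^^ e) (A n) (0, 0) \<noteq> 0" for n
  proof -
    consider "s n < e" | "s n = e" | "s n > e" by linarith
    then show ?thesis
    proof cases
      case 1
      obtain d where d: "e = s n + d" "d > 0" using 1 by (metis less_imp_add_positive)
      \<comment> \<open>Here the order in \<open>y\<close> would drop below \<open>e\<close>, against minimality.\<close>
      have "near0 (\<lambda>z. fst z ^ s n * (fst z ^ d * blow_up (c n) ((Dy ^^ e) (A n)) z) = fst z ^ s n * (Dy ^^ e) (A (Suc n)) z)"
        using rel[of e n] by (simp only: d(1) power_add mult.assoc)
      then have "near0 (\<lambda>z. fst z ^ d * blow_up (c n) ((Dy ^^ e) (A n)) z = (Dy ^^ e) (A (Suc n)) z)"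
        by (rule near0_cancel_fst[rotated 2])
          (intro holo2_germ_mult holo2_germ_power holo2_germ_fst holo2_germ_blow_up hA)+
      from near0_slice[OF this] have "\<forall>\<^sub>F y in nhds 0. (Dy ^^ e) (A (Suc n)) (0, y) = 0"
      proof eventually_elim
        case (elim y)
        have "(Dy ^^ e) (A (Suc n)) (0, y) = 0 ^ d * blow_up (c n) ((Dy ^^ e) (A n)) (0, y)"
          using elim by simp
        also have "\<dots> = 0" using d(2) by simp
        finally show ?case .
      qed
      then have top: "\<forall>\<^sub>F y in nhds 0. (deriv ^^ e) (\<lambda>y. A (Suc n) (0, y)) y = 0"
        by (simp add: Dy_funpow_eq)
      \<comment> \<open>Below \<open>e\<close> by minimality, from \<open>e\<close> on because the derivative of order \<open>e\<close> vanishes on the divisor.\<close>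
      have "(deriv ^^ j) (\<lambda>y. A (Suc n) (0, y)) 0 = 0" for j
      proof (cases "j < e")
        case True
        then show ?thesis using below[of j "Suc n"] by (simp add: Dy_funpow_eq)
      next
        case False
        then have "j = (j - e) + e" by simp
        then have "(deriv ^^ j) (\<lambda>y. A (Suc n) (0, y)) = (deriv ^^ (j - e)) ((deriv ^^ e) (\<lambda>y. A (Suc n) (0, y)))"
          by (metis funpow_add o_apply)
        then show ?thesis using funpow_deriv_eventually_zero[OF top] by simp
      qed
      then show ?thesis using analytic_zero_of_derivs[OF holo2_germ_slice[OF A(1)[of "Suc n"]]] A(2)[of "Suc n"] by simp
    next
      case 2
      have "near0 (\<lambda>z. blow_up (c n) ((Dy ^^ e) (A n)) z = (Dy ^^ e) (A (Suc n)) z)"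
        using near0_cancel_fst[OF holo2_germ_blow_up[OF hA] hA rel[of e n, unfolded 2]] .
      from eventually_nhds_x_imp_x[OF this] show ?thesis using n 2 by (simp add: blow_up_def)
    next
      case 3
      obtain d where d: "s n = e + d" "d > 0" using 3 by (metis less_imp_add_positive)
      \<comment> \<open>Here the derivative of order \<open>e\<close>, nonzero at the centre, would be divisible by \<open>x\<close>.\<close>
      have "near0 (\<lambda>z. fst z ^ e * blow_up (c n) ((Dy ^^ e) (A n)) z = fst z ^ e * (fst z ^ d * (Dy ^^ e) (A (Suc n)) z))"
        using rel[of e n] by (simp only: d(1) power_add mult.assoc)
      then have "near0 (\<lambda>z. blow_up (c n) ((Dy ^^ e) (A n)) z = fst z ^ d * (Dy ^^ e) (A (Suc n)) z)"
        by (rule near0_cancel_fst[rotated 2])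
          (intro holo2_germ_mult holo2_germ_power holo2_germ_fst holo2_germ_blow_up hA)+
      from eventually_nhds_x_imp_x[OF this] show ?thesis using n d(2) by (simp add: blow_up_def)
    qed
  qed
  have stable: "(Dy ^^ e) (A n) (0, 0) \<noteq> 0" if "n \<ge> m" for n
    using that by (induction n rule: dec_induct) (use m step in auto)
  define h where "h n = (Dy ^^ (e - 1)) (A n)" for n
  have "holo2_germ (h n) \<and> h n (0, 0) = 0 \<and> Dy (h n) (0, 0) \<noteq> 0 \<and>
     near0 (\<lambda>z. blow_up (c n) (h n) z = fst z * h (Suc n) z)" if n: "n \<ge> m" for n
  proof (intro conjI)
    show hh: "holo2_germ (h n)" for n unfolding h_def by (rule hA)
    show "h n (0, 0) = 0" unfolding h_def using below \<open>e > 0\<close> by simp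
    have "Dy (h n) = (Dy ^^ e) (A n)"
      using \<open>e > 0\<close> by (cases e) (simp_all add: h_def)
    then show "Dy (h n) (0, 0) \<noteq> 0" using stable[OF n] by simp
    have "s n = e" using step stable[OF n] by blast
    then have "s n = (e - 1) + 1" using \<open>e > 0\<close> by simp
    then have "near0 (\<lambda>z. fst z ^ (e - 1) * blow_up (c n) (h n) z = fst z ^ (e - 1) * (fst z * h (Suc n) z))"
      using rel[of "e - 1" n] by (simp add: h_def mult_ac)
    then show "near0 (\<lambda>z. blow_up (c n) (h n) z = fst z * h (Suc n) z)"
      by (rule near0_cancel_fst[rotated 2])
        (intro holo2_germ_mult holo2_germ_fst holo2_germ_blow_up hh)+
  qed
  then show thesis using that by blast
qed

lemma analytic_graph_map:
  assumes "f analytic_on {0}" "f 0 = 0" "\<psi> analytic_on {0}" "\<psi> 0 = (0 :: complex)"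
  shows "((\<lambda>x. (f x, \<psi> x)) \<longlongrightarrow> (0, 0)) (nhds 0)"
  using tendsto_Pair[OF analytic_at_tendsto[OF assms(1)] analytic_at_tendsto[OF assms(3)]] assms(2,4) by simp

lemma near0_graph:
  assumes "near0 P" "\<psi> analytic_on {0}" "\<psi> 0 = 0"
  shows "\<forall>\<^sub>F x in nhds 0. P (x, \<psi> x)"
  using eventually_compose_filterlim[OF assms(1) analytic_graph_map[OF analytic_on_ident _ assms(2,3)]] by simp

text \<open>
  The curve \<open>y = \<psi> n x\<close> at stage \<open>n\<close> is carried by the chart to the curve of the preceding stage.
\<close>

definition follows_centres :: "(nat \<Rightarrow> complex) \<Rightarrow> (nat \<Rightarrow> complex \<Rightarrow> complex) \<Rightarrow> nat \<Rightarrow> bool" where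
  "follows_centres c \<psi> n \<longleftrightarrow> \<psi> n analytic_on {0} \<and> \<psi> n 0 = 0 \<and> 
     (\<forall>\<^sub>F x in nhds 0. \<psi> n x = x * (c n + \<psi> (Suc n) x))"

text \<open>
  The smooth curves of the late stages are graphs by the implicit function theorem. Uniqueness of the
  implicit function identifies the image of one under the chart with its predecessor. The earlier stages are
  obtained by pushing forward.
\<close>

lemma infinitely_near_curve:
  assumes f: "holo2_germ f" "\<not> near0 (\<lambda>z. f z = 0)" and inf: "infinitely_near c f"
  obtains \<psi> where "\<And>n. follows_centres c \<psi> n"
proof -
  obtain m h where h: "\<And>n. n \<ge> m \<Longrightarrow> holo2_germ (h n) \<and> h n (0, 0) = 0 \<and> Dy (h n) (0, 0) \<noteq> 0 \<and>
     near0 (\<lambda>z. blow_up (c n) (h n) z = fst z * h (Suc n) z)"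
    by (rule infinitely_near_smooth_germs[OF f inf]) blast
  have "\<exists>\<psi>. \<psi> analytic_on {0} \<and> \<psi> 0 = 0 \<and> near0 (\<lambda>z. h n z = 0 \<longleftrightarrow> snd z = \<psi> (fst z))" if "n \<ge> m" for n
  proof -
    have "holo2_germ (h n)" "h n (0, 0) = 0" "Dy (h n) (0, 0) \<noteq> 0" using h[OF that] by blast+
    then show ?thesis by (rule holo2_implicit_function) blast
  qed
  then have "\<exists>\<psi>. \<forall>n. n \<ge> m \<longrightarrow> \<psi> n analytic_on {0} \<and> \<psi> n 0 = 0 \<and> near0 (\<lambda>z. h n z = 0 \<longleftrightarrow> snd z = \<psi> n (fst z))"
    by (intro choice) blast
  then obtain \<psi> where \<psi>: "\<And>n. n \<ge> m \<Longrightarrow> \<psi> n analytic_on {0}" "\<And>n. n \<ge> m \<Longrightarrow> \<psi> n 0 = 0"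
    "\<And>n. n \<ge> m \<Longrightarrow> near0 (\<lambda>z. h n z = 0 \<longleftrightarrow> snd z = \<psi> n (fst z))"
    by blast
  have tail: "follows_centres c \<psi> n" if n: "n \<ge> m" for n
  proof -
    have Sn: "Suc n \<ge> m" using n by simp
    have "near0 (\<lambda>z. h n (fst z, fst z * (c n + snd z)) = 0 \<longleftrightarrow> fst z * (c n + snd z) = \<psi> n (fst z))"
      using near0_blow_up[OF \<psi>(3)[OF n], of "c n"] by simp
    moreover have "near0 (\<lambda>z. blow_up (c n) (h n) z = fst z * h (Suc n) z)" using h[OF n] by blast
    ultimately have "near0 (\<lambda>z. snd z = \<psi> (Suc n) (fst z) \<longrightarrow> fst z * (c n + snd z) = \<psi> n (fst z))"
      using \<psi>(3)[OF Sn] by eventually_elim (auto simp: blow_up_def)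
    from near0_graph[OF this \<psi>(1,2)[OF Sn]] show ?thesis
      unfolding follows_centres_def using \<psi>(1,2)[OF n] by (auto elim!: eventually_mono)
  qed
  \<comment> \<open>Descends from stage \<open>m\<close> to stage \<open>0\<close>; truncated subtraction makes the descent stop there.\<close>
  have "\<exists>\<psi>. \<forall>n\<ge>m - d. follows_centres c \<psi> n" for d
  proof (induction d)
    case 0
    then show ?case using tail by auto
  next
    case (Suc d)
    then obtain \<psi> where \<psi>: "\<forall>n\<ge>m - d. follows_centres c \<psi> n" by blast
    show ?case
    proof (cases "m - d = 0")
      case True
      then show ?thesis using \<psi> by (intro exI[of _ \<psi>]) auto
    next
      case False
      define p where "p = m - Suc d"
      have p: "Suc p = m - d" using False by (simp add: p_def)
      define \<psi>' where "\<psi>' = \<psi>(p := \<lambda>x. x * (c p + \<psi> (Suc p) x))"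
      have Sp: "\<psi> (Suc p) analytic_on {0}" using \<psi> p unfolding follows_centres_def by auto
      have "follows_centres c \<psi>' n" if "n \<ge> p" for n
      proof (cases "n = p")
        case True
        have "\<psi>' p analytic_on {0}" unfolding \<psi>'_def using Sp by (auto intro!: analytic_intros)
        then show ?thesis using True by (simp add: follows_centres_def \<psi>'_def)
      next
        case False
        then have "n \<ge> m - d" using that p by auto
        then show ?thesis using \<psi> False that by (auto simp: follows_centres_def \<psi>'_def)
      qed
      then show ?thesis unfolding p_def by blast
    qed
  qed
  from this[of m] obtain \<psi> where "\<forall>n. follows_centres c \<psi> n" by auto
  then show thesis using that by blast
qed

lemma holo2_germ_graph_analytic:
  assumes f: "holo2_germ f" and \<psi>: "\<psi> analytic_on {0}" "\<psi> 0 = 0"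
  shows "(\<lambda>x. f (x, \<psi> x)) analytic_on {0}"
proof -
  obtain r where r: "r > 0" "\<psi> holomorphic_on ball 0 r" using \<psi>(1) by (rule analytic_at_ball)
  have "\<forall>\<^sub>F x in nhds 0. x \<in> ball (0::complex) r" using r(1) by (intro eventually_nhds_in_open) auto
  with near0_graph[OF f[unfolded holo2_germ_def] \<psi>]
  have "\<forall>\<^sub>F x in nhds 0. (\<lambda>x. f (x, \<psi> x)) field_differentiable (at x)"
  proof eventually_elim
    case (elim x)
    obtain a b where ab: "(f has_derivative (\<lambda>w. a * fst w + b * snd w)) (at (x, \<psi> x))"
      using elim by (auto simp: cdiff2_def)
    obtain d where "(\<psi> has_field_derivative d) (at x)" using r(2) elim holomorphic_on_open[OF open_ball] by blast
    then have "((\<lambda>x. (x, \<psi> x)) has_derivative (\<lambda>t. (t, d * t))) (at x)"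
      by (auto intro!: derivative_eq_intros simp: has_field_derivative_def)
    from diff_chain_at[OF this ab]
    have "((\<lambda>x. f (x, \<psi> x)) has_field_derivative (a + b * d)) (at x)"
      unfolding has_field_derivative_def o_def
      by (rule has_derivative_eq_rhs) (simp add: fun_eq_iff algebra_simps)
    then show ?case by (auto simp: field_differentiable_def)
  qed
  then obtain S where "open S" "0 \<in> S" "\<And>x. x \<in> S \<Longrightarrow> (\<lambda>x. f (x, \<psi> x)) field_differentiable (at x)"
    unfolding eventually_nhds by blast
  then show ?thesis unfolding analytic_at
    by (metis field_differentiable_at_within holomorphic_onI)
qed

text \<open>
  Along the curve, \<open>f\<close> equals its \<open>n\<close>-th pull-back along the curve of stage \<open>n\<close>, hence is divisible by
  \<open>x\<^sup>n\<close> for every \<open>n\<close>. Convergence of \<open>\<psi>\<close> is essential: it makes the restriction holomorphic and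
  therefore zero.
\<close>

lemma infinitely_near_zero_on_curve:
  assumes f: "holo2_germ f" "\<not> near0 (\<lambda>z. f z = 0)" and inf: "infinitely_near c f"
    and \<psi>: "\<And>n. follows_centres c \<psi> n"
  shows "\<forall>\<^sub>F x in nhds 0. f (x, \<psi> 0 x) = 0"
proof (rule ccontr)
  assume contr: "\<not> ?thesis"
  have \<psi>an: "\<psi> n analytic_on {0}" "\<psi> n 0 = 0" for n using \<psi> by (auto simp: follows_centres_def)
  obtain A k where A: "\<And>n. holo2_germ (A n)" "\<And>n. near0 (\<lambda>z. blow_ups c f n z = fst z ^ k n * A n z)"
    "\<And>n. k n < k (Suc n)"
    by (rule strict_transforms[OF f inf]) blast
  have kn: "k n \<ge> n" for n
    by (induction n) (use A(3) in \<open>auto simp: Suc_le_eq intro: le_less_trans\<close>)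
  have pull: "\<forall>\<^sub>F x in nhds 0. f (x, \<psi> 0 x) = blow_ups c f n (x, \<psi> n x)" for n
  proof (induction n)
    case (Suc n)
    have "\<forall>\<^sub>F x in nhds 0. \<psi> n x = x * (c n + \<psi> (Suc n) x)" using \<psi>[of n] by (auto simp: follows_centres_def)
    with Suc show ?case by eventually_elim (simp add: blow_up_def)
  qed simp
  obtain m u where u: "u analytic_on {0}" "u 0 \<noteq> 0" "\<forall>\<^sub>F x in nhds 0. f (x, \<psi> 0 x) = x ^ m * u x"
    using has_order0_exists[OF holo2_germ_graph_analytic[OF f(1) \<psi>an] contr] unfolding has_order0_def by blast
  define n where "n = Suc m"
  obtain d where d: "k n = Suc m + d" using le_Suc_ex[OF kn[of n]] unfolding n_def by auto
  have "\<forall>\<^sub>F x in nhds 0. x \<noteq> 0 \<longrightarrow> u x = x * (x ^ d * A n (x, \<psi> n x))"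
    using u(3) pull[of n] near0_graph[OF A(2)[of n] \<psi>an[of n]]
  proof eventually_elim
    case (elim x)
    have "x ^ m * u x = x ^ k n * A n (x, \<psi> n x)" using elim by simp
    also have "\<dots> = x ^ m * (x * (x ^ d * A n (x, \<psi> n x)))"
      by (simp only: d power_add power_Suc mult_ac)
    finally have "x ^ m * u x = x ^ m * (x * (x ^ d * A n (x, \<psi> n x)))" .
    then show ?case unfolding mult_cancel_left by auto
  qed
  then have ev: "\<forall>\<^sub>F x in at 0. u x = x * (x ^ d * A n (x, \<psi> n x))" by (simp add: eventually_at_filter)
  have "(\<lambda>x. x * (x ^ d * A n (x, \<psi> n x))) analytic_on {0}"
    by (intro analytic_intros holo2_germ_graph_analytic A(1) \<psi>an)
  then have "((\<lambda>x. x * (x ^ d * A n (x, \<psi> n x))) \<longlongrightarrow> 0) (at 0)" "(u \<longlongrightarrow> u 0) (at 0)"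
    using analytic_at_imp_isCont u(1) by (fastforce simp: isCont_def)+
  then have "u 0 = 0"
    using ev tendsto_cong tendsto_unique[OF at_neq_bot] by fast
  then show False using u(2) by simp
qed

text \<open>
  The curve depends only on the centres, which is why it can be found from \<open>P\<close> alone and still serves \<open>Q\<close>.
\<close>

theorem infinitely_near_common_zeros:
  assumes "holo2_germ P" "\<not> near0 (\<lambda>z. P z = 0)" "infinitely_near c P"
    and "holo2_germ Q" "\<not> near0 (\<lambda>z. Q z = 0)" "infinitely_near c Q"
  obtains \<psi> where "\<psi> analytic_on {0}" "\<psi> 0 = 0" 
     "\<forall>\<^sub>F x in nhds 0. P (x, \<psi> x) = 0 \<and> Q (x, \<psi> x) = 0"
proof -
  obtain \<psi> where \<psi>: "\<And>n. follows_centres c \<psi> n" 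
    by (rule infinitely_near_curve[OF assms(1-3)]) blast
  show thesis
    using that[of "\<psi> 0"] \<psi>[of 0] infinitely_near_zero_on_curve[OF assms(1-3) \<psi>]
      infinitely_near_zero_on_curve[OF assms(4-6) \<psi>] by (auto simp: follows_centres_def eventually_conj_iff)
qed

section \<open>Lifting maps and invariant quotients to blow-ups\<close>

definition invariant_quotient where
  "invariant_quotient P Q G1 G2 \<longleftrightarrow>
     near0 (\<lambda>z. P (G1 z, G2 z) * Q z = P z * (Q (G1 z, G2 z) :: complex))"

text \<open>
  The two equations say that \<open>(H1, H2)\<close> is a lift of \<open>(G1, G2)\<close> through the chart.
\<close>

lemma invariant_quotient_blow_up:
  assumes inv: "invariant_quotient P Q G1 G2"
    and "near0 (\<lambda>z. H1 z = blow_up c G1 z)" "near0 (\<lambda>z. H1 z * (c + H2 z) = blow_up c G2 z)"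
  shows "invariant_quotient (blow_up c P) (blow_up c Q) H1 H2"
  using near0_blow_up[OF inv[unfolded invariant_quotient_def], of c] assms(2,3)
  unfolding invariant_quotient_def by eventually_elim (simp add: blow_up_def)

text \<open>
  On the exceptional divisor the quotient by \<open>x\<close> is the derivative of \<open>f\<close> in the direction \<open>(1, y)\<close>.
\<close>

lemma blow_up_quotient_on_divisor:
  assumes f: "(f has_derivative (\<lambda>w. a * fst w + b * snd w)) (at (0, 0))" "f (0, 0) = 0"
    and g: "holo2_germ g" and eq: "near0 (\<lambda>z. blow_up 0 f z = fst z * g z)"
  shows "\<forall>\<^sub>F y in nhds 0. g (0, y) = a + b * y"
proof -
  obtain r where r: "r > 0" "\<And>x y. x \<in> ball 0 r \<Longrightarrow> y \<in> ball 0 r \<Longrightarrow> f (x, x * y) = x * g (x, y) \<and> cdiff2 g (x, y)"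
    using eventually_conj[OF eq g[unfolded holo2_germ_def]] unfolding near0_polydisc blow_up_def by auto
  have "g (0, y) = a + b * y" if y: "y \<in> ball 0 r" for y
  proof -
    have curve: "((\<lambda>x. (x, x * y)) has_derivative (\<lambda>t. (t, t * y))) (at 0)"
      by (auto intro!: derivative_eq_intros)
    have f': "(f has_derivative (\<lambda>w. a * fst w + b * snd w)) (at ((\<lambda>x. (x, x * y)) 0))" using f(1) by simp
    have "((\<lambda>x. f (x, x * y)) has_field_derivative (a + b * y)) (at 0)"
      unfolding has_field_derivative_def
      by (rule has_derivative_eq_rhs[OF diff_chain_at[OF curve f', unfolded o_def]]) (simp add: fun_eq_iff algebra_simps)
    then have lim: "(\<lambda>x. f (x, x * y) / x) \<midarrow>0\<rightarrow> a + b * y"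
      using f(2) by (simp add: DERIV_def)
    have "(\<lambda>x. g (x, y)) field_differentiable (at 0)" using r y by (intro cdiff2_imp_partial) auto
    then have lim2: "(\<lambda>x. g (x, y)) \<midarrow>0\<rightarrow> g (0, y)"
      using field_differentiable_imp_continuous_at isCont_def by blast
    have "\<forall>\<^sub>F x in at 0. f (x, x * y) / x = g (x, y)"
      using eventually_at_ball[OF r(1), of 0 UNIV] eventually_neq_at_within[of 0 0 UNIV]
      by eventually_elim (use r(2) y in auto)
    then have "(\<lambda>x. g (x, y)) \<midarrow>0\<rightarrow> a + b * y" using lim tendsto_cong by fast
    then show ?thesis using lim2 tendsto_unique[OF at_neq_bot] by blast
  qed
  then show ?thesis using r(1) by (auto simp: eventually_nhds_metric dist_commute)
qed

text \<open>
  The map \<open>(x, y) \<mapsto> (x g, h)\<close> preserves the divisor \<open>x = 0\<close>, acts on it by \<open>y \<mapsto> \<nu> y\<close>, and has multiplier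
  \<open>\<lambda>\<close> in the direction of \<open>x\<close> along it.
\<close>

definition divisor_map :: "complex \<Rightarrow> complex \<Rightarrow> (complex \<times> complex \<Rightarrow> complex) \<Rightarrow> (complex \<times> complex \<Rightarrow> complex) \<Rightarrow> bool" where
  "divisor_map lam nu g h \<longleftrightarrow> holo2_germ g \<and> holo2_germ h \<and>
     (\<forall>\<^sub>F y in nhds 0. g (0, y) = lam) \<and> (\<forall>\<^sub>F y in nhds 0. h (0, y) = nu * y)"

text \<open>
  The lift acts on the divisor as the linear map acts on directions, hence by \<open>\<mu> / \<lambda>\<close>. This treats
  \<open>\<mu> = 0\<close> and \<open>\<mu> \<noteq> 0\<close> alike.
\<close>

lemma lift_diagonal_map:
  assumes G: "holo2_germ G1" "holo2_germ G2" "G1 (0, 0) = 0" "G2 (0, 0) = 0"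
    and D: "(G1 has_derivative (\<lambda>w. lam * fst w + 0 * snd w)) (at (0, 0))"
      "(G2 has_derivative (\<lambda>w. 0 * fst w + mu * snd w)) (at (0, 0))" and lam: "lam \<noteq> 0"
  obtains g h where "divisor_map lam (mu / lam) g h"
    "near0 (\<lambda>z. fst z * g z = blow_up 0 G1 z)" "near0 (\<lambda>z. fst z * g z * (0 + h z) = blow_up 0 G2 z)"
proof -
  obtain g where g: "holo2_germ g" "near0 (\<lambda>z. blow_up 0 G1 z = fst z * g z)"
    by (rule holo2_germ_divide_fst[OF holo2_germ_blow_up[OF G(1), of 0]]) (simp_all add: blow_up_def G)
  obtain k where k: "holo2_germ k" "near0 (\<lambda>z. blow_up 0 G2 z = fst z * k z)"
    by (rule holo2_germ_divide_fst[OF holo2_germ_blow_up[OF G(2), of 0]]) (simp_all add: blow_up_def G)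
  have g0: "\<forall>\<^sub>F y in nhds 0. g (0, y) = lam"
    using blow_up_quotient_on_divisor[OF D(1) G(3) g] by simp
  have k0: "\<forall>\<^sub>F y in nhds 0. k (0, y) = mu * y"
    using blow_up_quotient_on_divisor[OF D(2) G(4) k] by simp
  have g00: "g (0, 0) \<noteq> 0" using eventually_nhds_x_imp_x[OF g0] lam by simp
  define h where "h z = k z / g z" for z
  have "holo2_germ h" unfolding h_def[abs_def] using k(1) g(1) g00 by (rule holo2_germ_divide)
  moreover have "\<forall>\<^sub>F y in nhds 0. h (0, y) = mu / lam * y"
    using g0 k0 by eventually_elim (simp add: h_def)
  moreover have "near0 (\<lambda>z. fst z * g z = blow_up 0 G1 z)" using g(2) by eventually_elim simp
  moreover have "near0 (\<lambda>z. fst z * g z * (0 + h z) = blow_up 0 G2 z)"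
    using k(2) holo2_germ_nonzero[OF g(1) g00] by eventually_elim (simp add: h_def)
  ultimately show thesis using that[of g h] g(1) g0 by (simp add: divisor_map_def)
qed

text \<open>
  For \<open>\<nu> = 0\<close> the divisor is contracted to the origin. The differential then has rank one with image spanned by
  \<open>(1, c)\<close>, so every direction other than that of the divisor is sent to this one, and the lift at
  the corresponding centre is a map of the same kind. The process can thus be repeated for ever. Its
  centres describe the formal invariant curve tangent to the eigenvector of \<open>\<lambda>\<close>, which need not converge.
\<close>

lemma lift_divisor_map:
  assumes gh: "divisor_map lam 0 g h" and lam: "lam \<noteq> 0"
  shows "\<exists>c g' h'. divisor_map lam 0 g' h' \<and>
    near0 (\<lambda>z. fst z * g' z = blow_up c (\<lambda>z. fst z * g z) z) \<and>
    near0 (\<lambda>z. fst z * g' z * (c + h' z) = blow_up c h z)"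
proof -
  have g: "holo2_germ g" "\<forall>\<^sub>F y in nhds 0. g (0, y) = lam" and h: "holo2_germ h" "\<forall>\<^sub>F y in nhds 0. h (0, y) = 0"
    using gh by (auto simp: divisor_map_def)
  obtain k where k: "holo2_germ k" "near0 (\<lambda>z. h z = fst z * k z)"
    by (rule holo2_germ_divide_fst[OF h])
  have g0: "g (0, 0) = lam" using eventually_nhds_x_imp_x[OF g(2)] by simp
  \<comment> \<open>The only centre for which the new second component vanishes at the origin.\<close>
  define c where "c = k (0, 0) / lam"
  define g' where "g' = blow_up c g"
  define h' where "h' z = blow_up c k z / g' z - c" for z
  have g': "holo2_germ g'" unfolding g'_def by (rule holo2_germ_blow_up[OF g(1)])
  have g'0: "g' (0, y) = lam" for y by (simp add: g'_def blow_up_def g0)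
  have h'0: "h' (0, y) = 0" for y by (simp add: h'_def g'0 blow_up_def c_def)
  have "holo2_germ h'"
    unfolding h'_def[abs_def] using g'0 lam
    by (intro holo2_germ_diff holo2_germ_divide holo2_germ_blow_up g' k(1) holo2_germ_const) simp
  moreover have "near0 (\<lambda>z. fst z * g' z = blow_up c (\<lambda>z. fst z * g z) z)"
    by (simp add: g'_def blow_up_def)
  moreover have "near0 (\<lambda>z. fst z * g' z * (c + h' z) = blow_up c h z)"
  proof -
    have "near0 (\<lambda>z. g' z \<noteq> 0)" using holo2_germ_nonzero[OF g'] g'0 lam by simp
    then show ?thesis using near0_blow_up[OF k(2), of c]
      by eventually_elim (simp add: h'_def blow_up_def)
  qed
  ultimately show ?thesis unfolding divisor_map_def using g' g'0 h'0
    by (intro exI[of _ c] exI[of _ g'] exI[of _ h']) simp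
qed

lemma divisor_map_tower:
  assumes "divisor_map lam 0 g0 h0" and lam: "lam \<noteq> 0"
  obtains c g h where "g 0 = g0" "h 0 = h0" "\<And>n. divisor_map lam 0 (g n) (h n)"
    "\<And>n. near0 (\<lambda>z. fst z * g (Suc n) z = blow_up (c n) (\<lambda>z. fst z * g n z) z)"
    "\<And>n. near0 (\<lambda>z. fst z * g (Suc n) z * (c n + h (Suc n) z) = blow_up (c n) (h n) z)"
proof -
  define R where "R c s s' \<longleftrightarrow> near0 (\<lambda>z. fst z * fst s' z = blow_up c (\<lambda>z. fst z * fst s z) z) \<and>
    near0 (\<lambda>z. fst z * fst s' z * (c + snd s' z) = blow_up c (snd s) z)"
    for c and s s' :: "(complex \<times> complex \<Rightarrow> complex) \<times> (complex \<times> complex \<Rightarrow> complex)"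
  define I where "I n s \<longleftrightarrow> divisor_map lam 0 (fst s) (snd s) \<and> (n = 0 \<longrightarrow> s = (g0, h0))"
    for n :: nat and s
  have "\<exists>s. I 0 s" using assms(1) by (intro exI[of _ "(g0, h0)"]) (simp add: I_def)
  moreover have "\<exists>s'. I (Suc n) s' \<and> (\<exists>c. R c s s')" if sI: "I n s" for s n
  proof -
    obtain c g' h' where "divisor_map lam 0 g' h'"
      "near0 (\<lambda>z. fst z * g' z = blow_up c (\<lambda>z. fst z * fst s z) z)"
      "near0 (\<lambda>z. fst z * g' z * (c + h' z) = blow_up c (snd s) z)"
      using lift_divisor_map[of lam "fst s" "snd s"] sI lam unfolding I_def by blast
    then have "I (Suc n) (g', h') \<and> R c s (g', h')" by (simp add: I_def R_def)
    then show ?thesis by blast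
  qed
  ultimately have "\<exists>f. \<forall>n. I n (f n) \<and> (\<exists>c. R c (f n) (f (Suc n)))"
    by (rule dependent_nat_choice)
  then obtain f where f: "\<And>n. I n (f n)" "\<forall>n. \<exists>c. R c (f n) (f (Suc n))" by blast
  obtain c where c: "\<forall>n. R (c n) (f n) (f (Suc n))" using choice[OF f(2)] ..
  show thesis
    by (rule that[of "\<lambda>n. fst (f n)" "\<lambda>n. snd (f n)" c]) (use f(1) c in \<open>auto simp: I_def R_def\<close>)
qed

lemma blow_ups_linear:
  "blow_ups c (\<lambda>z. P z - d * Q z) n = (\<lambda>z. blow_ups c P n z - d * blow_ups c Q n z)"
  by (induction n) (simp_all add: blow_up_def[abs_def])

lemma blow_ups_not_proportional:
  assumes "holo2_germ P" "holo2_germ Q" "\<And>d. \<not> near0 (\<lambda>z. P z = d * Q z)"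
  shows "\<not> near0 (\<lambda>z. blow_ups c P n z = d * blow_ups c Q n z)"
proof -
  have "holo2_germ (\<lambda>z. P z - d * Q z)" by (intro holo2_germ_diff holo2_germ_mult assms holo2_germ_const)
  then have "\<not> near0 (\<lambda>z. blow_ups c (\<lambda>z. P z - d * Q z) n z = 0)"
    by (rule blow_ups_nonzero) (use assms(3)[of d] in simp)
  then show ?thesis by (simp add: blow_ups_linear)
qed

text \<open>
  If at stage \<open>n\<close> the leading monomial of the denominator is a pure power \<open>x\<^sup>l\<close>, the resonance relation
  \<open>\<lambda>\<^sup>k 0\<^sup>i = \<lambda>\<^sup>l\<close> with \<open>(k, i) \<noteq> (l, 0)\<close> leaves only \<open>i = 0\<close> and \<open>k \<noteq> l\<close>.
\<close>

lemma root_of_unity_if_not_infinitely_near: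
  assumes lam: "lam \<noteq> 0" and tower: "\<And>n. divisor_map lam 0 (g n) (h n)"
    and inv: "\<And>n. invariant_quotient (blow_ups c P n) (blow_ups c Q n) (\<lambda>z. fst z * g n z) (h n)"
    and P: "holo2_germ P" and Q: "holo2_germ Q" "\<not> infinitely_near c Q"
    and nonprop: "\<And>d. \<not> near0 (\<lambda>z. P z = d * Q z)"
  shows "\<exists>n>0. lam ^ n = 1"
proof -
  obtain n l where l: "has_lex_order (blow_ups c Q n) l 0"
    using Q(2) by (auto simp: infinitely_near_def)
  have gh: "holo2_germ (g n)" "holo2_germ (h n)"
    "\<forall>\<^sub>F y in nhds 0. g n (0, y) = lam" "\<forall>\<^sub>F y in nhds 0. h n (0, y) = 0 * y"
    using tower[of n] by (auto simp: divisor_map_def)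
  obtain k i where ki: "(k, i) \<noteq> (l, 0)" "lam ^ k * 0 ^ i = lam ^ l * 0 ^ 0"
    using resonance_of_invariant_quotient[OF gh(1,3,2,4) holo2_germ_blow_ups[OF P] holo2_germ_blow_ups[OF Q(1)] l
        inv[of n, unfolded invariant_quotient_def] blow_ups_not_proportional[OF P Q(1) nonprop]] by blast
  have "i = 0" using ki(2) lam by (cases i) auto
  then have kl: "lam ^ k = lam ^ l" "k \<noteq> l" using ki by auto
  have "lam ^ (max k l - min k l) = 1"
    using kl lam by (simp add: power_diff max_def min_def)
  moreover have "max k l - min k l > 0" using kl(2) by (simp add: max_def min_def)
  ultimately show ?thesis by blast
qed

text \<open>
  For \<open>\<mu> \<noteq> 0\<close> a single blow-up gives the resonance. For \<open>\<mu> = 0\<close> the tower of blow-ups is used: were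
  neither \<open>P\<close> nor \<open>Q\<close> ever to have a pure power of \<open>x\<close> as leading monomial, both would vanish on a
  common curve through the origin. If it is \<open>P\<close> that does, the roles of \<open>P\<close> and \<open>Q\<close> are exchanged.
\<close>

theorem diagonal_map_invariant_quotient:
  assumes G: "holo2_germ G1" "holo2_germ G2" "G1 (0, 0) = 0" "G2 (0, 0) = 0"
    and D: "(G1 has_derivative (\<lambda>w. lam * fst w + 0 * snd w)) (at (0, 0))"
      "(G2 has_derivative (\<lambda>w. 0 * fst w + mu * snd w)) (at (0, 0))" and lam: "lam \<noteq> 0"
    and P: "holo2_germ P" and Q: "holo2_germ Q" "\<not> near0 (\<lambda>z. Q z = 0)"
    and nonprop: "\<And>d. \<not> near0 (\<lambda>z. P z = d * Q z)"
    and inv: "invariant_quotient P Q G1 G2"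
    and isol: "\<forall>\<^sub>F z in at (0, 0). \<not> (P z = 0 \<and> Q z = 0)"
  shows "mu \<noteq> 0 \<Longrightarrow> \<exists>p q :: int. (p, q) \<noteq> (0, 0) \<and> lam powi p * mu powi q = 1"
    and "mu = 0 \<Longrightarrow> \<exists>n>0. lam ^ n = 1"
proof -
  obtain g h where gh: "divisor_map lam (mu / lam) g h"
    "near0 (\<lambda>z. fst z * g z = blow_up 0 G1 z)" "near0 (\<lambda>z. fst z * g z * (0 + h z) = blow_up 0 G2 z)"
    by (rule lift_diagonal_map[OF G D lam])
  define P1 where "P1 = blow_up 0 P"
  define Q1 where "Q1 = blow_up 0 Q"
  have PQ1: "holo2_germ P1" "holo2_germ Q1" unfolding P1_def Q1_def using P Q by (auto intro: holo2_germ_blow_up)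
  have Q1nz: "\<not> near0 (\<lambda>z. Q1 z = 0)" unfolding Q1_def using blow_up_nonzero[OF Q(1)] Q(2) by blast
  have nonprop1: "\<not> near0 (\<lambda>z. P1 z = d * Q1 z)" for d
    using blow_ups_not_proportional[OF P Q(1) nonprop, of "\<lambda>_. 0" 1 d] by (simp add: P1_def Q1_def)
  have inv1: "invariant_quotient P1 Q1 (\<lambda>z. fst z * g z) h"
    unfolding P1_def Q1_def by (rule invariant_quotient_blow_up[OF inv gh(2,3)])
  {
    assume mu: "mu \<noteq> 0"
    obtain l j where lj: "has_lex_order Q1 l j" using has_lex_order_exists[OF PQ1(2) Q1nz] by blast
    obtain k i where ki: "(k, i) \<noteq> (l, j)" "lam ^ k * (mu / lam) ^ i = lam ^ l * (mu / lam) ^ j"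
      using resonance_of_invariant_quotient[OF _ _ _ _ PQ1 lj inv1[unfolded invariant_quotient_def] nonprop1]
        gh(1) unfolding divisor_map_def by blast
    define p where "p = int k - int i - int l + int j"
    define q where "q = int i - int j"
    have "lam powi p * mu powi q = (lam ^ k * (mu / lam) ^ i) / (lam ^ l * (mu / lam) ^ j)"
      using lam mu by (simp add: p_def q_def power_int_diff power_int_add power_divide field_simps)
    also have "\<dots> = 1" using ki(2) lam mu by simp
    finally have "lam powi p * mu powi q = 1" .
    moreover have "(p, q) \<noteq> (0, 0)" using ki(1) by (auto simp: p_def q_def)
    ultimately show "\<exists>p q :: int. (p, q) \<noteq> (0, 0) \<and> lam powi p * mu powi q = 1" by blast
  }
  {
    assume mu: "mu = 0"
    obtain c gs hs where tower: "gs 0 = g" "hs 0 = h" "\<And>n. divisor_map lam 0 (gs n) (hs n)"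
      "\<And>n. near0 (\<lambda>z. fst z * gs (Suc n) z = blow_up (c n) (\<lambda>z. fst z * gs n z) z)"
      "\<And>n. near0 (\<lambda>z. fst z * gs (Suc n) z * (c n + hs (Suc n) z) = blow_up (c n) (hs n) z)"
      by (rule divisor_map_tower[OF gh(1)[unfolded mu, simplified] lam]) blast
    have invs: "invariant_quotient (blow_ups c P1 n) (blow_ups c Q1 n) (\<lambda>z. fst z * gs n z) (hs n)" for n
    proof (induction n)
      case 0
      then show ?case using inv1 tower(1,2) by simp
    next
      case (Suc n)
      show ?case using invariant_quotient_blow_up[OF Suc tower(4,5)[of n]] by simp
    qed
    have P1nz: "\<not> near0 (\<lambda>z. P1 z = 0)" using nonprop1[of 0] by simp
    have "\<not> (infinitely_near c P1 \<and> infinitely_near c Q1)"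
    proof
      assume "infinitely_near c P1 \<and> infinitely_near c Q1"
      then obtain \<psi> where \<psi>: "\<psi> analytic_on {0}" "\<psi> 0 = 0" 
        "\<forall>\<^sub>F x in nhds 0. P1 (x, \<psi> x) = 0 \<and> Q1 (x, \<psi> x) = 0"
        using infinitely_near_common_zeros[OF PQ1(1) P1nz _ PQ1(2) Q1nz] by blast
      have "((\<lambda>x. (x, x * \<psi> x)) \<longlongrightarrow> (0, 0 * \<psi> 0)) (nhds 0)"
        by (intro tendsto_Pair tendsto_mult analytic_at_tendsto[OF \<psi>(1)] filterlim_ident)
      moreover have "near0 (\<lambda>z. z \<noteq> (0, 0) \<longrightarrow> \<not> (P z = 0 \<and> Q z = 0))"
        using isol by (simp add: eventually_at_filter)
      ultimately have "\<forall>\<^sub>F x in nhds 0. (x, x * \<psi> x) \<noteq> (0, 0) \<longrightarrow> \<not> (P (x, x * \<psi> x) = 0 \<and> Q (x, x * \<psi> x) = 0)"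
        using eventually_compose_filterlim by fastforce
      with \<psi>(3) have "\<forall>\<^sub>F x in nhds (0::complex). x = 0"
        by eventually_elim (auto simp: P1_def Q1_def blow_up_def)
      then have "\<forall>\<^sub>F x in at (0::complex). False" by (simp add: eventually_at_filter)
      then show False by simp
    qed
    then consider "\<not> infinitely_near c Q1" | "\<not> infinitely_near c P1" by blast
    then show "\<exists>n>0. lam ^ n = 1"
    proof cases
      case 1
      then show ?thesis by (intro root_of_unity_if_not_infinitely_near[OF lam tower(3) invs PQ1 _ nonprop1])
    next
      case 2
      have invs': "invariant_quotient (blow_ups c Q1 n) (blow_ups c P1 n) (\<lambda>z. fst z * gs n z) (hs n)" for n
        using invs[of n] unfolding invariant_quotient_def by eventually_elim (simp add: mult_ac)
      have "\<not> near0 (\<lambda>z. Q1 z = d * P1 z)" for d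
      proof
        assume eq: "near0 (\<lambda>z. Q1 z = d * P1 z)"
        show False
        proof (cases "d = 0")
          case True
          then show False using eq Q1nz by simp
        next
          case False
          have "near0 (\<lambda>z. P1 z = 1 / d * Q1 z)" using eq by eventually_elim (use False in simp)
          then show False using nonprop1 by blast
        qed
      qed
      then show ?thesis
        by (intro root_of_unity_if_not_infinitely_near[OF lam tower(3) invs' PQ1(2,1) 2])
    qed
  }
qed

section \<open>Meromorphic first integrals\<close>

lemma invertible_matrix_inv:
  assumes "invertible (S :: complex ^ 2 ^ 2)"
  shows "S ** matrix_inv S = mat 1" "matrix_inv S ** S = mat 1"
  using someI_ex[OF assms[unfolded invertible_def]] by (auto simp: matrix_inv_def)

lemma holo2_germ_if_holo2_on:
  assumes "holo2_on f U" "open U" "(0, 0) \<in> U"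
  shows "holo2_germ f"
  using eventually_nhds_in_open[OF assms(2,3)] assms(1)
  unfolding holo2_germ_def holo2_on_def by (auto elim: eventually_mono)

text \<open>
  If \<open>Q\<close> vanished near the origin, \<open>P / Q\<close> would count as constant there, vacuously. So this case is
  excluded by non-constancy, although \<open>Q\<close> is only required to be nonzero somewhere in \<open>U\<close>, which may be
  disconnected.
\<close>

lemma first_integral_not_proportional:
  assumes H: "meromorphic_first_integral U F P Q" and U: "open U" "(0, 0) \<in> U"
  shows "\<not> near0 (\<lambda>z. P z = d * Q z)" "\<not> near0 (\<lambda>z. Q z = 0)"
proof -
  have nonconst: False
    if "near0 (\<lambda>z. Q z \<noteq> 0 \<longrightarrow> P z / Q z = c)" for c
  proof -
    have "near0 (\<lambda>z. z \<in> U \<and> (Q z \<noteq> 0 \<longrightarrow> P z / Q z = c))"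
      using eventually_nhds_in_open[OF U] that by (rule eventually_conj)
    then obtain V where "open V" "(0, 0) \<in> V" "V \<subseteq> U" "\<forall>z\<in>V. Q z \<noteq> 0 \<longrightarrow> P z / Q z = c"
      unfolding eventually_nhds by blast
    then show False using H unfolding meromorphic_first_integral_def by blast
  qed
  show "\<not> near0 (\<lambda>z. P z = d * Q z)"
  proof
    assume "near0 (\<lambda>z. P z = d * Q z)"
    then have "near0 (\<lambda>z. Q z \<noteq> 0 \<longrightarrow> P z / Q z = d)" by eventually_elim simp
    then show False by (rule nonconst)
  qed
  show "\<not> near0 (\<lambda>z. Q z = 0)"
  proof
    assume "near0 (\<lambda>z. Q z = 0)"
    then have "near0 (\<lambda>z. Q z \<noteq> 0 \<longrightarrow> P z / Q z = 0)" by eventually_elim simp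
    then show False by (rule nonconst)
  qed
qed

lemma coprime2_isolated_zeros:
  assumes "coprime2_on U P Q" "open U" "(0, 0) \<in> U" "holo2_germ P" "holo2_germ Q"
  shows "near0 (\<lambda>z. z \<noteq> (0, 0) \<longrightarrow> \<not> (P z = 0 \<and> Q z = 0))"
proof (cases "P (0, 0) = 0 \<and> Q (0, 0) = 0")
  case True
  define Z where "Z = {z \<in> U. P z = 0 \<and> Q z = 0}"
  have "(0, 0) isolated_in Z"
    using assms(1,3) True by (auto simp: coprime2_on_def discrete_def Z_def)
  then obtain T where T: "open T" "T \<inter> Z = {(0, 0)}" by (auto simp: isolated_in_def)
  have "near0 (\<lambda>z. z \<in> T \<inter> U)"
    using T assms(2,3) by (intro eventually_nhds_in_open) auto
  then show ?thesis by eventually_elim (use T(2) in \<open>auto simp: Z_def\<close>)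
next
  case False
  then show ?thesis
    using holo2_germ_nonzero[OF assms(4)] holo2_germ_nonzero[OF assms(5)]
    by (auto elim!: eventually_mono)
qed

text \<open>
  The matrix \<open>S\<close> serves as a linear change of coordinates in which the differential of \<open>F\<close> becomes
  diagonal; all hypotheses are local at the origin and are carried over.
\<close>

theorem theorem1:
  fixes U :: "(complex \<times> complex) set"
    and F :: "complex \<times> complex \<Rightarrow> complex \<times> complex"
    and lam mu :: complex
  assumes "open U" and "(0, 0) \<in> U"
    and "analytic2_map_on F U"
    and "F (0, 0) = (0, 0)"
    and "diagonalizable_with_eigenvalues (jacobian_matrix2 F (0, 0)) lam mu"
    and "\<exists>P Q. meromorphic_first_integral U F P Q"
  shows "(lam * mu \<noteq> 0 \<longrightarrow> (\<exists>p q :: int. (p, q) \<noteq> (0, 0) \<and> lam powi p * mu powi q = 1)) \<and>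
         (lam \<noteq> 0 \<and> mu = 0 \<longrightarrow> (\<exists>n :: nat. n > 0 \<and> lam ^ n = 1))"
proof -
  note U = assms(1,2)
  obtain P Q where H: "meromorphic_first_integral U F P Q" using assms(6) by blast
  then have mero: "P analytic2_on U" "Q analytic2_on U" "coprime2_on U P Q"
    and inv: "\<And>z. z \<in> U \<Longrightarrow> F z \<in> U \<Longrightarrow> P (F z) * Q z = P z * Q (F z)"
    by (auto simp: meromorphic_first_integral_def meromorphic2_on_def)
  note germ = holo2_germ_if_holo2_on[OF analytic2_on_imp_holo2_on U]
  have P: "holo2_germ P" and Q: "holo2_germ Q" using mero by (auto intro: germ)
  define F1 where "F1 = (\<lambda>z. fst (F z))"
  define F2 where "F2 = (\<lambda>z. snd (F z))"
  have F: "F z = (F1 z, F2 z)" for z by (simp add: F1_def F2_def)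
  have F12: "holo2_germ F1" "holo2_germ F2" and F0: "F1 (0, 0) = 0" "F2 (0, 0) = 0"
    using assms(3,4) by (auto simp: analytic2_map_on_def F1_def F2_def intro: germ)
  obtain a1 b1 where D1: "(F1 has_derivative (\<lambda>w. a1 * fst w + b1 * snd w)) (at (0, 0))"
    using eventually_nhds_x_imp_x[OF F12(1)[unfolded holo2_germ_def]] by (auto simp: cdiff2_def)
  obtain a2 b2 where D2: "(F2 has_derivative (\<lambda>w. a2 * fst w + b2 * snd w)) (at (0, 0))"
    using eventually_nhds_x_imp_x[OF F12(2)[unfolded holo2_germ_def]] by (auto simp: cdiff2_def)
  define J :: "complex ^ 2 ^ 2" where "J = vector [vector [a1, b1], vector [a2, b2]]"
  have J: "jacobian_matrix2 F (0, 0) = J"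
    using has_derivative_partials[OF D1] has_derivative_partials[OF D2]
    by (simp add: jacobian_matrix2_def J_def F1_def F2_def DERIV_imp_deriv)
  define D :: "complex ^ 2 ^ 2" where "D = vector [vector [lam, 0], vector [0, mu]]"
  obtain S where S: "invertible S" "J = S ** D ** matrix_inv S"
    using assms(5) unfolding J diagonalizable_with_eigenvalues_def D_def by blast
  define T where "T = matrix_inv S"
  have ST: "S ** T = mat 1" and TS: "T ** S = mat 1"
    unfolding T_def by (rule invertible_matrix_inv[OF S(1)])+
  have "T ** (J ** S) = T ** (S ** D ** (T ** S))"
    by (simp add: S(2) T_def matrix_mul_assoc)
  also have "\<dots> = D" by (simp add: TS matrix_mul_assoc)
  finally have TJS: "T ** (J ** S) = D" .
  note comps = matrix_matrix_mult_def sum_2 mat_def J_def D_def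
  define app :: "complex ^ 2 ^ 2 \<Rightarrow> 2 \<Rightarrow> complex \<times> complex \<Rightarrow> complex"
    where "app M i z = M $ i $ 1 * fst z + M $ i $ 2 * snd z" for M i z
  have app_germ: "holo2_germ (app M i)" for M i
    unfolding app_def[abs_def] by (intro holo2_germ_add holo2_germ_mult) simp_all
  have app_0: "app M i (0, 0) = 0" for M i by (simp add: app_def)
  have app_mult: "app M i (app N 1 z, app N 2 z) = app (M ** N) i z" for M N i z
    by (simp add: app_def comps algebra_simps)
  have app_id: "app (mat 1) 1 z = fst z" "app (mat 1) 2 z = snd z" for z
    by (simp_all add: app_def mat_def)
  have ST_id: "(app S 1 (app T 1 z, app T 2 z), app S 2 (app T 1 z, app T 2 z)) = z"
    and TS_id: "(app T 1 (app S 1 z, app S 2 z), app T 2 (app S 1 z, app S 2 z)) = z" for z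
    by (simp_all add: app_mult ST TS app_id)
  note near0_app = near0_compose[OF _ app_germ app_germ app_0 app_0]
  define PS where "PS z = P (app S 1 z, app S 2 z)" for z
  define QS where "QS z = Q (app S 1 z, app S 2 z)" for z
  define FS1 where "FS1 z = F1 (app S 1 z, app S 2 z)" for z
  define FS2 where "FS2 z = F2 (app S 1 z, app S 2 z)" for z
  define G where "G i z = app T i (FS1 z, FS2 z)" for i z
  have germs: "holo2_germ PS" "holo2_germ QS" "holo2_germ FS1" "holo2_germ FS2"
    unfolding PS_def[abs_def] QS_def[abs_def] FS1_def[abs_def] FS2_def[abs_def]
    by (intro holo2_germ_compose app_germ app_0 P Q F12)+
  have FS_0: "FS1 (0, 0) = 0" "FS2 (0, 0) = 0" by (simp_all add: FS1_def FS2_def app_0 F0)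
  have G_germ: "holo2_germ (G i)" for i
    unfolding G_def[abs_def] by (rule holo2_germ_compose[OF app_germ germs(3,4) FS_0])
  have G_0: "G i (0, 0) = 0" for i by (simp add: G_def FS_0 app_0)
  have app_der: "(app M i has_derivative app M i) (at z)" for M i z
    unfolding app_def[abs_def] by (auto intro!: derivative_eq_intros)
  have S_der: "((\<lambda>z. (app S 1 z, app S 2 z)) has_derivative (\<lambda>w. (app S 1 w, app S 2 w))) (at (0, 0))"
    by (rule has_derivative_Pair[OF app_der app_der])
  have pull_S: "((\<lambda>z. f (app S 1 z, app S 2 z)) has_derivative (\<lambda>w. a * app S 1 w + b * app S 2 w)) (at (0, 0))"
    if f: "(f has_derivative (\<lambda>w. a * fst w + b * snd w)) (at (0, 0))" for f :: "complex \<times> complex \<Rightarrow> complex" and a b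
  proof -
    have "(f has_derivative (\<lambda>w. a * fst w + b * snd w)) (at ((\<lambda>z. (app S 1 z, app S 2 z)) (0, 0)))"
      using f by (simp add: app_0)
    from diff_chain_at[OF S_der this] show ?thesis by (simp add: o_def)
  qed
  have FS1_der: "(FS1 has_derivative app (J ** S) 1) (at (0, 0))"
    unfolding FS1_def[abs_def]
    by (rule has_derivative_eq_rhs[OF pull_S[OF D1]]) (simp add: fun_eq_iff app_def comps algebra_simps)
  have FS2_der: "(FS2 has_derivative app (J ** S) 2) (at (0, 0))"
    unfolding FS2_def[abs_def]
    by (rule has_derivative_eq_rhs[OF pull_S[OF D2]]) (simp add: fun_eq_iff app_def comps algebra_simps)
  have "(G i has_derivative app D i) (at (0, 0))" for i
    using diff_chain_at[OF has_derivative_Pair[OF FS1_der FS2_der] app_der, of T i]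
    by (simp add: G_def[abs_def] o_def app_mult TJS eta_contract_eq)
  moreover have "app D 1 = (\<lambda>w. lam * fst w + 0 * snd w)" "app D 2 = (\<lambda>w. 0 * fst w + mu * snd w)"
    by (simp_all add: app_def[abs_def] D_def)
  ultimately have G_der: "(G 1 has_derivative (\<lambda>w. lam * fst w + 0 * snd w)) (at (0, 0))"
    "(G 2 has_derivative (\<lambda>w. 0 * fst w + mu * snd w)) (at (0, 0))"
    by metis+
  have nonprop: "\<not> near0 (\<lambda>z. PS z = d * QS z)" for d
  proof
    assume "near0 (\<lambda>z. PS z = d * QS z)"
    from near0_app[OF this, of T 1 T 2] show False
      using first_integral_not_proportional(1)[OF H U, of d] by (simp add: PS_def QS_def ST_id)
  qed
  have QS_nz: "\<not> near0 (\<lambda>z. QS z = 0)"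
  proof
    assume "near0 (\<lambda>z. QS z = 0)"
    from near0_app[OF this, of T 1 T 2] show False
      using first_integral_not_proportional(2)[OF H U] by (simp add: QS_def ST_id)
  qed
  have inv_germ: "invariant_quotient PS QS (G 1) (G 2)"
  proof -
    have inU: "near0 (\<lambda>z. z \<in> U)" using U by (intro eventually_nhds_in_open)
    have "near0 (\<lambda>z. P (F z) * Q z = P z * Q (F z))"
      using inU near0_compose[OF inU F12 F0] by eventually_elim (rule inv, simp_all add: F)
    from near0_app[OF this, of S 1 S 2] show ?thesis
      unfolding invariant_quotient_def
      by eventually_elim (simp add: PS_def QS_def G_def ST_id, simp add: F FS1_def FS2_def)
  qed
  have isol: "\<forall>\<^sub>F z in at (0, 0). \<not> (PS z = 0 \<and> QS z = 0)"
  proof -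
    have "near0 (\<lambda>z. z \<noteq> (0, 0) \<longrightarrow> \<not> (PS z = 0 \<and> QS z = 0))"
      using near0_app[OF coprime2_isolated_zeros[OF mero(3) U P Q], of S 1 S 2]
    proof eventually_elim
      case (elim z)
      have "z = (0, 0)" if "(app S 1 z, app S 2 z) = (0, 0)"
        using TS_id[of z] unfolding that by (simp add: app_0)
      then show ?case using elim unfolding PS_def QS_def by blast
    qed
    then show ?thesis by (simp add: eventually_at_filter)
  qed
  note main = diagonal_map_invariant_quotient[OF G_germ G_germ G_0 G_0 G_der _ germs(1,2) QS_nz nonprop inv_germ isol]
  show ?thesis
  proof (intro conjI impI)
    assume "lam * mu \<noteq> 0"
    then show "\<exists>p q :: int. (p, q) \<noteq> (0, 0) \<and> lam powi p * mu powi q = 1"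
      by (intro main(1)) auto
  next
    assume "lam \<noteq> 0 \<and> mu = 0"
    then show "\<exists>n :: nat. n > 0 \<and> lam ^ n = 1"
      using main(2) by blast
  qed
qed

end
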